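(* If $0<q<\min\{p,2\}$, then there exists a function $f\in(\mathcal D^p_{p-1}\cap H^\infty)\setminus(\mathcal D^q_{q-1}\cap H^\infty)$.
   Context: $\mathbb D$ is the open unit disc, $dA=\frac1\pi dx\,dy$. For $0<p<\infty$, $\mathcal D^p_{p-1}$ is the space of analytic $f$ in $\mathbb D$ with $\int_{\mathbb D}(1-|z|)^{p-1}|f'(z)|^p\,dA(z)<\infty$. $H^\infty$ is the space of bounded analytic functions on $\mathbb D$. *)

theory Defs
  imports "HOL-Analysis.Analysis"
begin

text \<open>Normalized area measure dA = (1/pi) dx dy on the complex plane (identified with R^2).\<close>

definition dirichlet_type :: "real \<Rightarrow> (complex \<Rightarrow> complex) set" where
  "dirichlet_type p = {f. f holomorphic_on ball 0 1 \<and>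
     (\<integral>\<^sup>+ z \<in> ball 0 1. ennreal ((1 / pi) * (1 - cmod z) powr (p - 1) * cmod (deriv f z) powr p) \<partial>lborel) < \<infinity>}"

definition Hinf :: "(complex \<Rightarrow> complex) set" where
  "Hinf = {f. f holomorphic_on ball 0 1 \<and> bounded (f ` ball 0 1)}"

end

theory Submission
  imports Defs "HOL-Complex_Analysis.Complex_Analysis"
begin

text \<open>
  Put \<open>a\<^sub>k = (k + 1) powr (-1/q)\<close>, so that \<open>a\<^sub>k powr q\<close> is not summable, while
  \<open>a\<^sub>k powr p\<close> and, as \<open>q < 2\<close>, also \<open>a\<^sub>k\<^sup>2\<close> are. The Rudin--Shapiro type recursion
  \<open>P\<^sub>k\<^sub>+\<^sub>1 = P\<^sub>k + a\<^sub>k z^n\<^sub>k Q\<^sub>k\<close>, \<open>Q\<^sub>k\<^sub>+\<^sub>1 = z^n\<^sub>k Q\<^sub>k - a\<^sub>k P\<^sub>k\<close> with \<open>P\<^sub>0 = 0\<close>, \<open>Q\<^sub>0 = 1\<close>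
  multiplies \<open>|P|\<^sup>2 + |Q|\<^sup>2\<close> by at most \<open>1 + a\<^sub>k\<^sup>2\<close> on the closed disc, so
  \<open>f = lim P\<^sub>k = \<Sum> a\<^sub>k z^n\<^sub>k Q\<^sub>k\<close> is bounded.

  If \<open>n\<^sub>k\<close> grows fast enough, the disc splits into annuli, the \<open>k\<close>-th of which contains
  \<open>1 - 2/n\<^sub>k \<le> |z| < 1 - 1/n\<^sub>k\<close>, such that on the \<open>k\<close>-th annulus \<open>f'\<close> is
  \<open>a\<^sub>k n\<^sub>k z^(n\<^sub>k - 1) Q\<^sub>k\<close> up to an error that is negligible in the weighted integrals.
  This annulus therefore contributes at most a constant times \<open>a\<^sub>k powr s\<close> to the
  integral with exponent \<open>s\<close>. For \<open>s \<le> 2\<close> it also contributes at least such a multiple: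
  \<open>Q\<^sub>k\<close> is monic and bounded, so its mean square over circles near the unit circle, and
  hence its mean \<open>s\<close>-th power, is bounded below.
\<close>

section \<open>Area measure on the complex plane\<close>

lemma sets_borel_ball [measurable]: "ball c r \<in> sets (borel :: complex measure)"
  by simp

text \<open>Lebesgue measure is determined by its values on boxes, and a complex box is a product of
  two real intervals.\<close>

lemma distr_Complex_lborel:
  "distr (lborel \<Otimes>\<^sub>M lborel) borel (\<lambda>(x, y). Complex x y) = lborel"
proof (rule lborel_eqI[symmetric])
  have [measurable]: "(\<lambda>(x, y). Complex x y) \<in> borel_measurable (lborel \<Otimes>\<^sub>M lborel)"
    unfolding lborel_prod case_prod_beta measurable_lborel2
    by (intro borel_measurable_continuous_onI continuous_intros)
  fix l u :: complex
  assume "\<And>b. b \<in> Basis \<Longrightarrow> l \<bullet> b \<le> u \<bullet> b"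
  from this[of 1] this[of \<i>] have lu: "Re l \<le> Re u" "Im l \<le> Im u"
    by (auto simp: Basis_complex_def)
  have "(\<lambda>(x, y). Complex x y) -` box l u = {Re l<..<Re u} \<times> {Im l<..<Im u}"
    by (auto simp: box_def Basis_complex_def)
  then have "emeasure (distr (lborel \<Otimes>\<^sub>M lborel) borel (\<lambda>(x, y). Complex x y)) (box l u) =
      emeasure lborel {Re l<..<Re u} * emeasure lborel {Im l<..<Im u}"
    by (simp add: emeasure_distr lborel.emeasure_pair_measure_Times space_pair_measure)
  also have "\<dots> = (\<Prod>b\<in>Basis. (u - l) \<bullet> b)"
    using lu by (simp add: Basis_complex_def ennreal_mult'[symmetric] complex_eq_iff)
  finally show "emeasure (distr (lborel \<Otimes>\<^sub>M lborel) borel (\<lambda>(x, y). Complex x y)) (box l u) =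
      (\<Prod>b\<in>Basis. (u - l) \<bullet> b)" .
qed simp

text \<open>Tonelli in real coordinates. Both orders are recorded because each kind of shear is
  treated by integrating first over the coordinate that it moves.\<close>

lemma nn_integral_complex:
  assumes [measurable]: "f \<in> borel_measurable borel"
  shows "(\<integral>\<^sup>+z. f z \<partial>lborel) = (\<integral>\<^sup>+x. \<integral>\<^sup>+y. f (Complex x y) \<partial>lborel \<partial>lborel)"
    and "(\<integral>\<^sup>+z. f z \<partial>lborel) = (\<integral>\<^sup>+y. \<integral>\<^sup>+x. f (Complex x y) \<partial>lborel \<partial>lborel)"
proof -
  have [measurable]: "(\<lambda>(x, y). Complex x y) \<in> borel_measurable (lborel \<Otimes>\<^sub>M lborel)"
    unfolding lborel_prod case_prod_beta measurable_lborel2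
    by (intro borel_measurable_continuous_onI continuous_intros)
  have *: "(\<integral>\<^sup>+z. f z \<partial>lborel) = (\<integral>\<^sup>+w. f (case w of (x, y) \<Rightarrow> Complex x y) \<partial>(lborel \<Otimes>\<^sub>M lborel))"
    by (subst distr_Complex_lborel[symmetric], subst nn_integral_distr) simp_all
  show "(\<integral>\<^sup>+z. f z \<partial>lborel) = (\<integral>\<^sup>+x. \<integral>\<^sup>+y. f (Complex x y) \<partial>lborel \<partial>lborel)"
    unfolding * by (subst lborel.nn_integral_fst[symmetric]) simp_all
  show "(\<integral>\<^sup>+z. f z \<partial>lborel) = (\<integral>\<^sup>+y. \<integral>\<^sup>+x. f (Complex x y) \<partial>lborel \<partial>lborel)"
    unfolding * by (subst lborel_pair.nn_integral_snd[symmetric]) simp_all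
qed

text \<open>With the other coordinate frozen, a shear is a translation of the moved coordinate,
  which the inner integral does not see.\<close>

lemma nn_integral_shear:
  fixes f :: "complex \<Rightarrow> ennreal"
  assumes [measurable]: "f \<in> borel_measurable borel"
  shows "(\<integral>\<^sup>+z. f (Complex (Re z + t * Im z) (Im z)) \<partial>lborel) = (\<integral>\<^sup>+z. f z \<partial>lborel)"
    and "(\<integral>\<^sup>+z. f (Complex (Re z) (Im z + t * Re z)) \<partial>lborel) = (\<integral>\<^sup>+z. f z \<partial>lborel)"
proof -
  have [measurable]: "(\<lambda>z. Complex (Re z + t * Im z) (Im z)) \<in> borel_measurable borel"
    "(\<lambda>z. Complex (Re z) (Im z + t * Re z)) \<in> borel_measurable borel"
    "(\<lambda>x. Complex x y) \<in> borel_measurable borel" "Complex x \<in> borel_measurable borel" for x y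
    by (auto intro!: borel_measurable_continuous_onI continuous_intros)
  have *: "(\<integral>\<^sup>+x. g (x + c) \<partial>lborel) = (\<integral>\<^sup>+x. g x \<partial>lborel)"
    if [measurable]: "g \<in> borel_measurable borel" for g :: "real \<Rightarrow> ennreal" and c
    by (subst nn_integral_real_affine[of g 1 c]) (simp_all add: add.commute)
  show "(\<integral>\<^sup>+z. f (Complex (Re z + t * Im z) (Im z)) \<partial>lborel) = (\<integral>\<^sup>+z. f z \<partial>lborel)"
    by (subst (1 2) nn_integral_complex(2)) (simp_all add: *[of "\<lambda>x. f (Complex x _)"])
  show "(\<integral>\<^sup>+z. f (Complex (Re z) (Im z + t * Re z)) \<partial>lborel) = (\<integral>\<^sup>+z. f z \<partial>lborel)"
    by (subst (1 2) nn_integral_complex(1)) (simp_all add: *[of "\<lambda>y. f (Complex _ y)"])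
qed

text \<open>A rotation other than \<open>\<plusminus>1\<close> is a product of three shears.\<close>

lemma nn_integral_rotate:
  fixes f :: "complex \<Rightarrow> ennreal"
  assumes f: "f \<in> borel_measurable borel" and c: "cmod c = 1"
  shows "(\<integral>\<^sup>+z. f (c * z) \<partial>lborel) = (\<integral>\<^sup>+z. f z \<partial>lborel)"
proof -
  have *: "(\<integral>\<^sup>+z. g (c * z) \<partial>lborel) = (\<integral>\<^sup>+z. g z \<partial>lborel)"
    if [measurable]: "g \<in> borel_measurable borel" and c: "cmod c = 1" "Im c \<noteq> 0"
    for g :: "complex \<Rightarrow> ennreal" and c
  proof -
    define s where "s = Im c"
    \<comment> \<open>For \<open>c = cis \<theta>\<close> this is -tan(\<theta>/2), the value that
      makes \<open>S1 (S2 (S1 z))\<close> the rotation by \<open>c\<close>; the division is why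
      \<open>Im c \<noteq> 0\<close> is assumed.\<close>
    define t where "t = (Re c - 1) / s"
    define S1 S2 where "S1 z = Complex (Re z + t * Im z) (Im z)"
      and "S2 z = Complex (Re z) (Im z + s * Re z)" for z
    have [measurable]: "S1 \<in> borel_measurable borel" "S2 \<in> borel_measurable borel"
      unfolding S1_def S2_def
      by (auto intro!: borel_measurable_continuous_onI continuous_intros)
    have s: "s * t = Re c - 1" "s \<noteq> 0" using c by (simp_all add: s_def t_def)
    have c1: "Re c ^ 2 + s ^ 2 = 1"
      using c(1) by (simp add: cmod_def s_def)
    have "s * (t * (2 + s * t)) = s * (- s)"
      using s(1) c1 by algebra
    then have t2: "t * (2 + s * t) = - s" using s(2) by (simp only: mult_cancel_left simp_thms)
    have "c * z = S1 (S2 (S1 z))" for z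
    proof -
      have c_eq: "Re c = 1 + s * t" "Im c = s" using s by (auto simp: s_def)
      show ?thesis
        unfolding S1_def S2_def complex_eq_iff times_complex.sel complex.sel c_eq using t2
        by algebra
    qed
    then have "(\<integral>\<^sup>+z. g (c * z) \<partial>lborel) = (\<integral>\<^sup>+z. g (S1 (S2 (S1 z))) \<partial>lborel)"
      by simp
    also have "\<dots> = (\<integral>\<^sup>+z. g (S1 (S2 z)) \<partial>lborel)"
      by (subst (2) S1_def, rule nn_integral_shear(1)) measurable
    also have "\<dots> = (\<integral>\<^sup>+z. g (S1 z) \<partial>lborel)"
      by (subst S2_def, rule nn_integral_shear(2)) measurable
    also have "\<dots> = (\<integral>\<^sup>+z. g z \<partial>lborel)"
      by (subst S1_def, rule nn_integral_shear(1)) measurable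
    finally show ?thesis .
  qed
  show ?thesis
  proof (cases "Im c = 0")
    \<comment> \<open>Here \<open>c\<close> is 1 or -1. It is written as (-i c) times i, two
      unimodular factors with nonzero imaginary part.\<close>
    case True
    have "(\<integral>\<^sup>+z. f (c * z) \<partial>lborel) = (\<integral>\<^sup>+z. f (c * (- \<i>) * (\<i> * z)) \<partial>lborel)"
      by (simp add: mult.assoc)
    also have "\<dots> = (\<integral>\<^sup>+z. f (c * (- \<i>) * z) \<partial>lborel)"
      by (rule *) (use f in auto)
    also have "\<dots> = (\<integral>\<^sup>+z. f z \<partial>lborel)"
      using c True f by (intro *) (auto simp: norm_mult cmod_def)
    finally show ?thesis .
  qed (use * f c in auto)
qed

section \<open>Polar coordinates for radial functions\<close>

lemma emeasure_ball_complex: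
  "0 \<le> r \<Longrightarrow> emeasure lborel (ball 0 r :: complex set) = ennreal (pi * r\<^sup>2)"
  by (subst emeasure_ball) (simp_all add: unit_ball_vol_2)

text \<open>Both sides integrate \<open>h\<close> against a finite measure on the line:
  \<open>M\<close> is the image of area on the disc under \<open>cmod\<close>, and \<open>N\<close>
  has density 2 pi r on (0,1). The two agree on every half-line \<open>{x<..}\<close>, where
  \<open>M\<close> is a difference of areas of discs.\<close>

lemma nn_integral_radial_unit_ball:
  fixes h :: "real \<Rightarrow> ennreal"
  assumes [measurable]: "h \<in> borel_measurable borel"
  shows "(\<integral>\<^sup>+z\<in>ball 0 1. h (cmod z) \<partial>lborel) = (\<integral>\<^sup>+r\<in>{0<..<1}. h r * ennreal (2 * pi * r) \<partial>lborel)"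
proof -
  define M where "M = distr (density lborel (indicator (ball 0 1 :: complex set))) borel cmod"
  define N where "N = density lborel (\<lambda>r. ennreal (2 * pi * r) * indicator {0<..<1::real} r)"
  have M: "emeasure M {x<..} = (if x < 0 then pi else if x < 1 then pi - pi * x\<^sup>2 else 0)" for x
  proof -
    have "emeasure M {x<..} = emeasure (density lborel (indicator (ball 0 1))) {z::complex. x < cmod z}"
      unfolding M_def by (subst emeasure_distr) (auto simp: vimage_def)
    also have "\<dots> = emeasure lborel (ball 0 1 \<inter> {z::complex. x < cmod z})"
      by (subst emeasure_density) (simp_all add: borel_measurable_indicator flip: indicator_inter_arith)
    also have "ball 0 1 \<inter> {z::complex. x < cmod z} =
        (if x < 0 then ball 0 1 else if x < 1 then ball 0 1 - cball 0 x else {})"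
      using norm_ge_zero[where 'a = complex] by (auto simp: not_less intro: less_le_trans)
    also have "emeasure lborel \<dots> = (if x < 0 then pi else if x < 1 then pi - pi * x\<^sup>2 else 0)"
    proof -
      have "emeasure lborel (ball 0 1 - cball 0 x :: complex set) = ennreal (pi - pi * x\<^sup>2)"
        if "0 \<le> x" "x < 1"
        using that emeasure_lborel_cball_finite[of "0::complex" x]
        by (subst emeasure_Diff)
           (auto simp: emeasure_ball emeasure_cball unit_ball_vol_2 ennreal_minus)
      then show ?thesis by (auto simp: emeasure_ball_complex)
    qed
    finally show ?thesis .
  qed
  have N: "emeasure N {x<..} = (if x < 0 then pi else if x < 1 then pi - pi * x\<^sup>2 else 0)" for x
  proof -
    \<comment> \<open>Up to endpoints, which are null, the half-line meets (0,1) in [l, u]. Taking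
      \<open>max 1 l\<close> for \<open>u\<close> collapses the interval to a point when
      \<open>x \<ge> 1\<close>, so one integral covers all cases.\<close>
    define l where "l = max 0 x"
    define u where "u = max 1 l"
    have "emeasure N {x<..} = (\<integral>\<^sup>+r. ennreal (2 * pi * r) * indicator {0<..<1} r * indicator {x<..} r \<partial>lborel)"
      unfolding N_def by (rule emeasure_density) measurable
    also have "\<dots> = (\<integral>\<^sup>+r. ennreal (2 * pi * r) * indicator {l..u} r \<partial>lborel)"
    proof (rule nn_integral_cong_AE)
      have "AE r in lborel. r \<noteq> l" "AE r in lborel. r \<noteq> u"
        by (rule AE_lborel_singleton)+
      then show "AE r in lborel. ennreal (2 * pi * r) * indicator {0<..<1} r * indicator {x<..} r =
          ennreal (2 * pi * r) * indicator {l..u} r"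
      proof eventually_elim
        case (elim r)
        then have "r \<in> {0<..<1} \<and> r \<in> {x<..} \<longleftrightarrow> r \<in> {l..u}"
          by (auto simp: l_def u_def max_def split: if_splits)
        then show ?case by (auto simp: indicator_def)
      qed
    qed
    also have "\<dots> = ennreal (pi * u\<^sup>2 - pi * l\<^sup>2)"
    proof (rule nn_integral_FTC_Icc)
      show "((\<lambda>r. pi * r\<^sup>2) has_real_derivative 2 * pi * r) (at r)" for r
        by (auto intro!: derivative_eq_intros)
    qed (auto simp: l_def u_def)
    also have "pi * u\<^sup>2 - pi * l\<^sup>2 = (if x < 0 then pi else if x < 1 then pi - pi * x\<^sup>2 else 0)"
      by (auto simp: l_def u_def max_def)
    finally show ?thesis .
  qed
  have "M = N"
  proof (rule measure_eqI_lessThan)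
    show "emeasure M {x<..} < \<infinity>" for x by (auto simp: M)
  qed (auto simp: M N, simp_all add: M_def N_def)
  have "(\<integral>\<^sup>+z\<in>ball 0 1. h (cmod z) \<partial>lborel) = (\<integral>\<^sup>+r. h r \<partial>M)"
    unfolding M_def by (subst nn_integral_distr) (auto simp: nn_integral_density mult.commute)
  also have "\<dots> = (\<integral>\<^sup>+r\<in>{0<..<1}. h r * ennreal (2 * pi * r) \<partial>lborel)"
    unfolding \<open>M = N\<close> N_def by (subst nn_integral_density) (auto simp: ac_simps)
  finally show ?thesis .
qed

section \<open>Weighted integrals over the unit disc\<close>

text \<open>The value of 2 pi n^s e^s Gamma(s) / (s n)^s, in which the powers of n cancel; this
  makes the kernel estimate uniform in the frequency n.\<close>

definition disc_kernel_bound :: "real \<Rightarrow> real" where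
  "disc_kernel_bound s = 2 * pi * exp s * Gamma s / s powr s"

text \<open>The substitution r = 1 - x/c gives c^(-s) times a truncated Gamma integral, which is at
  most the full one.\<close>

lemma nn_integral_powr_exp_le:
  assumes "s > 0" "c > 0"
  shows "(\<integral>\<^sup>+r\<in>{0<..<1}. ennreal ((1 - r) powr (s - 1) * exp (- (c * (1 - r)))) \<partial>lborel)
    \<le> ennreal (Gamma s / c powr s)"
proof -
  let ?f = "\<lambda>r. ennreal ((1 - r) powr (s - 1) * exp (- (c * (1 - r)))) * indicator {0<..<1} r"
  have "(\<integral>\<^sup>+x. ?f (1 + -(1/c) * x) \<partial>lborel) \<le>
      (\<integral>\<^sup>+x. ennreal (1 / c powr (s - 1)) * ennreal (indicator {0..} x * x powr (s - 1) / exp x) \<partial>lborel)"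
  proof (rule nn_integral_mono)
    fix x :: real
    have "(1 - (1 + - (1 / c) * x)) powr (s - 1) * exp (- (c * (1 - (1 + - (1 / c) * x)))) =
        1 / c powr (s - 1) * (x powr (s - 1) / exp x)" if "x \<ge> 0"
    proof -
      have "1 - (1 + - (1 / c) * x) = x / c" "c * (x / c) = x"
        using assms by simp_all
      then show ?thesis
        using assms that by (simp only: powr_divide exp_minus) (simp add: divide_inverse)
    qed
    moreover have "x \<ge> 0" if "1 + - (1 / c) * x < 1"
      using that assms by (simp add: zero_less_divide_iff)
    ultimately show "?f (1 + - (1 / c) * x) \<le>
        ennreal (1 / c powr (s - 1)) * ennreal (indicator {0..} x * x powr (s - 1) / exp x)"
      by (cases "x \<ge> 0") (auto simp: ennreal_mult'[symmetric] indicator_def simp del: minus_mult_minus)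
  qed
  also have "\<dots> = ennreal (1 / c powr (s - 1)) *
      (\<integral>\<^sup>+x. ennreal (indicator {0..} x * x powr (s - 1) / exp x) \<partial>lborel)"
    by (rule nn_integral_cmult) measurable
  also have "(\<integral>\<^sup>+x. ennreal (indicator {0..} x * x powr (s - 1) / exp x) \<partial>lborel) = ennreal (Gamma s)"
    using assms(1) by (rule Gamma_conv_nn_integral_real[symmetric])
  finally have "ennreal \<bar>-(1/c)\<bar> * (\<integral>\<^sup>+x. ?f (1 + -(1/c) * x) \<partial>lborel) \<le>
      ennreal \<bar>-(1/c)\<bar> * (ennreal (1 / c powr (s - 1)) * ennreal (Gamma s))"
    by (rule mult_left_mono) simp
  also have "\<dots> = ennreal (Gamma s / c powr s)"
    using assms by (simp add: ennreal_mult'[symmetric] powr_diff)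
  also have "ennreal \<bar>-(1/c)\<bar> * (\<integral>\<^sup>+x. ?f (1 + -(1/c) * x) \<partial>lborel) = (\<integral>\<^sup>+r. ?f r \<partial>lborel)"
    using assms by (intro nn_integral_real_affine[symmetric]) auto
  finally show ?thesis .
qed

text \<open>The kernel n r^(n-1) is large only where 1 - r is of order 1/n, and there the weight
  compensates its growth. Precisely, r \<le> e^(r-1) bounds the kernel by e n e^(-n(1-r)), and the
  Gamma estimate applies with c = s n.\<close>

lemma disc_kernel_bound:
  assumes s: "s > 0" and n: "n \<ge> (1::nat)"
  shows "(\<integral>\<^sup>+z\<in>ball 0 1. ennreal ((1 - cmod z) powr (s - 1) * (n * cmod z ^ (n - 1)) powr s) \<partial>lborel)
    \<le> ennreal (disc_kernel_bound s)"
proof -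
  have pw: "(n * r ^ (n - 1)) powr s \<le> n powr s * exp s * exp (- (s * n * (1 - r)))"
    if r: "0 < r" "r < 1" for r :: real
  proof -
    have "r \<le> exp (r - 1)"
      using exp_ge_add_one_self[of "r - 1"] by simp
    then have "r ^ (n - 1) \<le> exp (r - 1) ^ (n - 1)"
      using r by (intro power_mono) auto
    also have "\<dots> = exp ((r - 1) * (real n - 1))"
      using n by (simp add: exp_of_nat_mult[symmetric] of_nat_diff mult.commute)
    also have "\<dots> \<le> exp (1 - n * (1 - r))"
      using r by (simp add: algebra_simps)
    finally have "n * r ^ (n - 1) \<le> n * exp (1 - n * (1 - r))"
      by (intro mult_left_mono) auto
    then have "(n * r ^ (n - 1)) powr s \<le> (n * exp (1 - n * (1 - r))) powr s"
      using s r by (intro powr_mono2) auto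
    also have "\<dots> = n powr s * exp s * exp (- (s * n * (1 - r)))"
      by (subst powr_mult) (auto simp: exp_powr_real mult_exp_exp algebra_simps)
    finally show ?thesis .
  qed
  have "(\<integral>\<^sup>+z\<in>ball 0 1. ennreal ((1 - cmod z) powr (s - 1) * (n * cmod z ^ (n - 1)) powr s) \<partial>lborel)
    = (\<integral>\<^sup>+r\<in>{0<..<1}. ennreal ((1 - r) powr (s - 1) * (n * r ^ (n - 1)) powr s) * ennreal (2 * pi * r) \<partial>lborel)"
    by (rule nn_integral_radial_unit_ball) measurable
  also have "\<dots> \<le> (\<integral>\<^sup>+r. ennreal (2 * pi * (n powr s * exp s)) *
      (ennreal ((1 - r) powr (s - 1) * exp (- (s * n * (1 - r)))) * indicator {0<..<1} r) \<partial>lborel)"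
  proof (intro nn_integral_mono)
    fix r :: real
    have "(1 - r) powr (s - 1) * (n * r ^ (n - 1)) powr s * (2 * pi * r) \<le>
        (1 - r) powr (s - 1) * (n powr s * exp s * exp (- (s * n * (1 - r)))) * (2 * pi * 1)"
      if "0 < r" "r < 1"
      using that pw[OF that] by (intro mult_mono) auto
    then show "ennreal ((1 - r) powr (s - 1) * (n * r ^ (n - 1)) powr s) * ennreal (2 * pi * r) *
        indicator {0<..<1} r \<le> ennreal (2 * pi * (n powr s * exp s)) *
      (ennreal ((1 - r) powr (s - 1) * exp (- (s * n * (1 - r)))) * indicator {0<..<1} r)"
      by (auto split: split_indicator simp: ennreal_mult'[symmetric] mult_ac intro!: ennreal_leI)
  qed
  also have "\<dots> = ennreal (2 * pi * (n powr s * exp s)) * (\<integral>\<^sup>+r\<in>{0<..<1}.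
      ennreal ((1 - r) powr (s - 1) * exp (- (s * n * (1 - r)))) \<partial>lborel)"
    by (rule nn_integral_cmult) measurable
  also have "\<dots> \<le> ennreal (2 * pi * (n powr s * exp s)) * ennreal (Gamma s / (s * n) powr s)"
    using s n by (intro mult_left_mono nn_integral_powr_exp_le) auto
  also have "\<dots> = ennreal (disc_kernel_bound s)"
    using s n by (simp add: disc_kernel_bound_def ennreal_mult'[symmetric] powr_mult field_simps)
  finally show ?thesis .
qed

lemma disc_kernel_bound_pos: "s > 0 \<Longrightarrow> disc_kernel_bound s > 0"
  by (simp add: disc_kernel_bound_def Gamma_real_pos)

lemma weight_integral_le:
  "s > 0 \<Longrightarrow> (\<integral>\<^sup>+z\<in>ball 0 1. ennreal ((1 - cmod z) powr (s - 1)) \<partial>lborel) \<le> ennreal (disc_kernel_bound s)"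
  using disc_kernel_bound[of s 1] by simp

text \<open>The weight is integrable already with \<open>s / 2\<close> in place of \<open>s\<close>, which leaves
  a factor \<open>(1 - r) powr (s / 2)\<close> to spare.\<close>

lemma weight_integral_tail_le:
  assumes s: "s > 0" and r: "r \<le> 1"
  shows "(\<integral>\<^sup>+z\<in>ball 0 1 - ball 0 r. ennreal ((1 - cmod z) powr (s - 1)) \<partial>lborel)
    \<le> ennreal ((1 - r) powr (s / 2) * disc_kernel_bound (s / 2))"
proof -
  have "(\<integral>\<^sup>+z\<in>ball 0 1 - ball 0 r. ennreal ((1 - cmod z) powr (s - 1)) \<partial>lborel) \<le>
    (\<integral>\<^sup>+z. ennreal ((1 - r) powr (s / 2)) *
      (ennreal ((1 - cmod z) powr (s / 2 - 1)) * indicator (ball 0 1) z) \<partial>lborel)"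
  proof (intro nn_integral_mono)
    fix z :: complex
    have "(1 - cmod z) powr (s - 1) \<le> (1 - r) powr (s / 2) * (1 - cmod z) powr (s / 2 - 1)"
      if "r \<le> cmod z" "cmod z < 1"
    proof -
      have "(1 - cmod z) powr (s - 1) = (1 - cmod z) powr (s / 2) * (1 - cmod z) powr (s / 2 - 1)"
        by (subst powr_add[symmetric]) simp
      also have "\<dots> \<le> (1 - r) powr (s / 2) * (1 - cmod z) powr (s / 2 - 1)"
        using that s by (intro mult_right_mono powr_mono2) auto
      finally show ?thesis .
    qed
    then show "ennreal ((1 - cmod z) powr (s - 1)) * indicator (ball 0 1 - ball 0 r) z \<le>
      ennreal ((1 - r) powr (s / 2)) *
      (ennreal ((1 - cmod z) powr (s / 2 - 1)) * indicator (ball 0 1) z)"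
      by (auto split: split_indicator simp: ennreal_mult'[symmetric] not_less intro!: ennreal_leI)
  qed
  also have "\<dots> = ennreal ((1 - r) powr (s / 2)) *
      (\<integral>\<^sup>+z\<in>ball 0 1. ennreal ((1 - cmod z) powr (s / 2 - 1)) \<partial>lborel)"
    by (rule nn_integral_cmult) measurable
  also have "\<dots> \<le> ennreal ((1 - r) powr (s / 2)) * ennreal (disc_kernel_bound (s / 2))"
    using s by (intro mult_left_mono weight_integral_le) auto
  finally show ?thesis by (simp add: ennreal_mult')
qed

text \<open>The factor (1-r)^(s/2) tends to 0, so any constant \<open>K\<close> fixed beforehand is
  absorbed by taking \<open>r\<close> close to 1.\<close>

lemma eventually_weight_tail_small:
  assumes s: "s > 0" and e: "e > 0"
  shows "\<forall>\<^sub>F r in at_left 1. ennreal K * (\<integral>\<^sup>+z\<in>ball 0 1 - ball 0 r. ennreal ((1 - cmod z) powr (s - 1)) \<partial>lborel)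
    \<le> ennreal e"
proof -
  have "((\<lambda>r. K * ((1 - r) powr (s / 2) * disc_kernel_bound (s / 2))) \<longlongrightarrow>
      K * ((1 - 1) powr (s / 2) * disc_kernel_bound (s / 2))) (at_left (1::real))"
    using s by (intro tendsto_intros tendsto_powr') (auto simp: eventually_at_filter)
  then have "\<forall>\<^sub>F r in at_left 1. K * ((1 - r) powr (s / 2) * disc_kernel_bound (s / 2)) < e"
    using e by (intro order_tendstoD) auto
  moreover have "\<forall>\<^sub>F r in at_left 1. r < (1::real)"
    by (auto simp: eventually_at_filter)
  ultimately show ?thesis
  proof eventually_elim
    case (elim r)
    have "ennreal K * (\<integral>\<^sup>+z\<in>ball 0 1 - ball 0 r. ennreal ((1 - cmod z) powr (s - 1)) \<partial>lborel)
      \<le> ennreal K * ennreal ((1 - r) powr (s / 2) * disc_kernel_bound (s / 2))"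
      using elim s by (intro mult_left_mono weight_integral_tail_le) auto
    also have "\<dots> = ennreal (K * ((1 - r) powr (s / 2) * disc_kernel_bound (s / 2)))"
      using s disc_kernel_bound_pos[of "s / 2"] by (intro ennreal_mult''[symmetric]) auto
    also have "\<dots> \<le> ennreal e"
      using elim by (intro ennreal_leI) auto
    finally show ?case .
  qed
qed

text \<open>The half-open annuli partition the disc, and the measure with density \<open>h\<close>
  is countably additive.\<close>

lemma suminf_nn_integral_annuli:
  fixes h :: "complex \<Rightarrow> ennreal" and r :: "nat \<Rightarrow> real"
  assumes [measurable]: "h \<in> borel_measurable borel"
    and r: "r 0 = 0" "mono r" "r \<longlonglongrightarrow> 1" "\<And>k. r k \<le> 1"
  shows "(\<Sum>k. \<integral>\<^sup>+z\<in>ball 0 (r (Suc k)) - ball 0 (r k). h z \<partial>lborel) = (\<integral>\<^sup>+z\<in>ball 0 1. h z \<partial>lborel)"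
proof -
  define A :: "nat \<Rightarrow> complex set" where "A k = ball 0 (r (Suc k)) - ball 0 (r k)" for k
  have [measurable]: "A k \<in> sets borel" for k by (simp add: A_def)
  have "disjoint_family A"
    unfolding disjoint_family_on_def
  proof (intro ballI impI)
    have "A i \<inter> A j = {}" if "i < j" for i j
      using monoD[OF r(2), of "Suc i" j] that by (auto simp: A_def)
    then show "A i \<inter> A j = {}" if "i \<noteq> j" for i j
      using that by (metis Int_commute linorder_neqE_nat)
  qed
  have "(\<Union>k. A k) = ball 0 1"
  proof (intro equalityI subsetI)
    fix z :: complex
    assume "z \<in> (\<Union>k. A k)"
    then obtain k where "cmod z < r (Suc k)" by (auto simp: A_def)
    then show "z \<in> ball 0 1" using r(4)[of "Suc k"] by simp
  next
    fix z :: complex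
    assume "z \<in> ball 0 1"
    then have "\<forall>\<^sub>F k in sequentially. cmod z < r k"
      using r(3) by (intro order_tendstoD) auto
    then have ex: "\<exists>k. cmod z < r k" by (auto dest: eventually_happens)
    \<comment> \<open>The least such index is positive because \<open>r 0 = 0\<close>; its
      predecessor is the index of the annulus that contains \<open>z\<close>.\<close>
    define k where "k = (LEAST k. cmod z < r k)"
    have k: "cmod z < r k" unfolding k_def using ex by (rule LeastI_ex)
    then have "k \<noteq> 0" using r(1) by (auto intro: gr0I)
    then obtain j where j: "k = Suc j" by (cases k) auto
    have "\<not> cmod z < r j" unfolding k_def using j k_def not_less_Least[of j] by (metis lessI)
    then show "z \<in> (\<Union>k. A k)" using k j by (auto simp: A_def)
  qed
  have e: "emeasure (density lborel h) S = (\<integral>\<^sup>+z\<in>S. h z \<partial>lborel)" if "S \<in> sets borel" for S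
    using that by (intro emeasure_density) auto
  have "(\<Sum>k. emeasure (density lborel h) (A k)) = emeasure (density lborel h) (\<Union>k. A k)"
    using \<open>disjoint_family A\<close> by (intro suminf_emeasure) auto
  then show ?thesis
    unfolding \<open>(\<Union>k. A k) = ball 0 1\<close> by (simp add: e A_def)
qed

section \<open>Mean values of monic polynomials over annuli\<close>

text \<open>As \<open>\<omega> ^ (N + 1) = 1\<close>, the factor \<open>\<omega> ^ j\<close> equals \<open>\<omega> ^ (- j * N)\<close> and extracts
  the leading coefficient.\<close>

lemma sum_poly_roots_unity:
  fixes Q :: "complex poly"
  defines "N \<equiv> degree Q"
  defines "\<omega> \<equiv> cis (2 * pi / Suc N)"
  shows "(\<Sum>j\<le>N. \<omega> ^ j * poly Q (\<omega> ^ j * z)) = Suc N * lead_coeff Q * z ^ N"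
proof -
  \<comment> \<open>The ratio is the power \<open>Suc i\<close> because of the extra factor
    \<omega>^j. For \<open>i \<le> N\<close> it equals 1 only when \<open>i = N\<close>; otherwise
    the geometric sum runs over a full period and vanishes.\<close>
  have geo: "(\<Sum>j\<le>N. (\<omega> ^ Suc i) ^ j) = (if i = N then of_nat (Suc N) else 0)" if "i \<le> N" for i
  proof (cases "i = N")
    case True
    have "\<omega> ^ Suc N = 1"
      unfolding \<omega>_def Complex.DeMoivre by (simp add: cis_2pi)
    with True show ?thesis by simp
  next
    case False
    have "\<omega> ^ Suc i = cis (2 * pi * (Suc i / Suc N))"
      unfolding \<omega>_def Complex.DeMoivre by (simp add: field_simps)
    moreover have "cis (2 * pi * (Suc i / Suc N)) \<noteq> 1"
    proof
      assume "cis (2 * pi * (Suc i / Suc N)) = 1"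
      then have "cos (2 * pi * (Suc i / Suc N)) = 1"
        by (metis cis.sel(1) one_complex.sel(1))
      then obtain m :: int where m: "2 * pi * (Suc i / Suc N) = real_of_int m * 2 * pi"
        unfolding cos_one_2pi_int by blast
      then have "real (Suc i) / Suc N = m"
        by (simp only: mult.assoc mult.commute[of "of_int m"] mult_cancel_left) simp
      moreover have "0 < real (Suc i) / Suc N" "real (Suc i) / Suc N < 1"
        using False that by simp_all
      ultimately have "0 < real_of_int m" "real_of_int m < 1" by metis+
      then show False by simp
    qed
    ultimately have ne: "\<omega> ^ Suc i \<noteq> 1" by simp
    have "(\<omega> ^ Suc i) ^ Suc N = (\<omega> ^ Suc N) ^ Suc i"
      by (simp only: power_mult[symmetric] mult.commute)
    also have "\<omega> ^ Suc N = 1"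
      unfolding \<omega>_def Complex.DeMoivre by (simp add: cis_2pi)
    finally show ?thesis
      using geometric_sum[OF ne, of "Suc N"] False
      by (simp only: lessThan_Suc_atMost power_one diff_self div_0 if_False)
  qed
  have "(\<Sum>j\<le>N. \<omega> ^ j * poly Q (\<omega> ^ j * z)) =
      (\<Sum>j\<le>N. \<Sum>i\<le>N. coeff Q i * z ^ i * (\<omega> ^ Suc i) ^ j)"
    unfolding poly_altdef N_def[symmetric] sum_distrib_left
    by (intro sum.cong refl) (simp add: power_mult_distrib power_mult[symmetric] power_add[symmetric] mult_ac)
  also have "\<dots> = (\<Sum>i\<le>N. coeff Q i * z ^ i * (\<Sum>j\<le>N. (\<omega> ^ Suc i) ^ j))"
    by (subst sum.swap) (simp only: sum_distrib_left)
  also have "\<dots> = (\<Sum>i\<le>N. if i = N then coeff Q i * z ^ i * of_nat (Suc N) else 0)"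
    by (intro sum.cong refl) (simp add: geo del: power_Suc)
  also have "\<dots> = Suc N * lead_coeff Q * z ^ N"
    by (simp add: N_def)
  finally show ?thesis .
qed

text \<open>A discrete substitute for Parseval: the triangle inequality and Cauchy-Schwarz applied
  to the formula that extracts the leading coefficient.\<close>

lemma monic_poly_roots_unity_mean_square:
  fixes Q :: "complex poly"
  defines "N \<equiv> degree Q"
  defines "\<omega> \<equiv> cis (2 * pi / Suc N)"
  assumes "lead_coeff Q = 1"
  shows "Suc N * (cmod z ^ N)\<^sup>2 \<le> (\<Sum>j\<le>N. (cmod (poly Q (\<omega> ^ j * z)))\<^sup>2)"
proof -
  have "Suc N * cmod z ^ N = cmod (\<Sum>j\<le>N. \<omega> ^ j * poly Q (\<omega> ^ j * z))"
    using sum_poly_roots_unity[of Q z] assms(3)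
    by (simp add: N_def \<omega>_def norm_mult norm_power del: of_nat_Suc)
  also have "\<dots> \<le> (\<Sum>j\<le>N. cmod (\<omega> ^ j * poly Q (\<omega> ^ j * z)))"
    by (rule norm_sum)
  also have "\<dots> = (\<Sum>j\<le>N. cmod (poly Q (\<omega> ^ j * z)))"
    by (simp add: norm_mult norm_power \<omega>_def)
  finally have "(Suc N * cmod z ^ N)\<^sup>2 \<le> (\<Sum>j\<le>N. cmod (poly Q (\<omega> ^ j * z)))\<^sup>2"
    by (intro power_mono) auto
  also have "\<dots> \<le> Suc N * (\<Sum>j\<le>N. (cmod (poly Q (\<omega> ^ j * z)))\<^sup>2)"
    using sum_squared_le_sum_of_squares[of "\<lambda>j. cmod (poly Q (\<omega> ^ j * z))" "{..N}"]
    by (simp only: card_atMost mult.commute)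
  finally have "Suc N * (Suc N * (cmod z ^ N)\<^sup>2) \<le> Suc N * (\<Sum>j\<le>N. (cmod (poly Q (\<omega> ^ j * z)))\<^sup>2)"
    by (simp only: power_mult_distrib power2_eq_square[of "real (Suc N)"] mult.assoc)
  then show ?thesis
    by (rule mult_left_le_imp_le) simp
qed

text \<open>Averaging over the rotations by powers of \<omega> brings in the discrete mean square,
  which is at least \<rho>^(2N) on the annulus. The bound \<open>B\<close> passes from exponent 2 to
  exponent \<open>s\<close>, and the remaining factor is the area of the annulus.\<close>

lemma nn_integral_annulus_monic_poly:
  fixes Q :: "complex poly"
  assumes lc: "lead_coeff Q = 1" and B: "B > 0" "\<And>z. cmod z < \<sigma> \<Longrightarrow> cmod (poly Q z) \<le> B"
    and s: "0 < s" "s \<le> 2" and \<rho>: "0 \<le> \<rho>" "\<rho> \<le> \<sigma>"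
  shows "ennreal (B powr (s - 2) * \<rho> ^ (2 * degree Q) * (pi * (\<sigma>\<^sup>2 - \<rho>\<^sup>2))) \<le>
    (\<integral>\<^sup>+z\<in>ball 0 \<sigma> - ball 0 \<rho>. ennreal (cmod (poly Q z) powr s) \<partial>lborel)"
proof -
  define N where "N = degree Q"
  define \<omega> where "\<omega> = cis (2 * pi / Suc N)"
  define A :: "complex set" where "A = ball 0 \<sigma> - ball 0 \<rho>"
  have [measurable]: "A \<in> sets borel" by (simp add: A_def)
  have [measurable]: "poly Q \<in> borel_measurable borel"
    by (intro borel_measurable_continuous_onI continuous_intros)
  have w: "cmod (\<omega> ^ j) = 1" for j by (simp add: \<omega>_def norm_power)
  have A_rot: "c * z \<in> A \<longleftrightarrow> z \<in> A" if "cmod c = 1" for c z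
    using that by (auto simp: A_def norm_mult)
  \<comment> \<open>Since s - 2 \<le> 0, the power x^(s-2) is smallest at the upper bound
    \<open>B\<close>. The point 0 is treated apart because \<open>powr\<close> sends it to 0 even
    for a negative exponent.\<close>
  have sq: "B powr (s - 2) * x\<^sup>2 \<le> x powr s" if x: "0 \<le> x" "x \<le> B" for x
  proof (cases "x = 0")
    case False
    with x have "B powr (s - 2) \<le> x powr (s - 2)"
      using s by (intro powr_mono2') auto
    then have "B powr (s - 2) * x\<^sup>2 \<le> x powr (s - 2) * x\<^sup>2"
      by (rule mult_right_mono) simp
    also have "\<dots> = x powr (s - 2) * x powr 2"
      using x by (simp only: powr_numeral)
    also have "\<dots> = x powr s"
      by (simp only: powr_add[symmetric] diff_add_cancel)
    finally show ?thesis .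
  qed auto
  have pw: "Suc N * (B powr (s - 2) * \<rho> ^ (2 * N)) \<le> (\<Sum>j\<le>N. cmod (poly Q (\<omega> ^ j * z)) powr s)"
    if z: "z \<in> A" for z
  proof -
    have "Suc N * (B powr (s - 2) * \<rho> ^ (2 * N)) \<le> B powr (s - 2) * (Suc N * (cmod z ^ N)\<^sup>2)"
    proof -
      have "\<rho> ^ N \<le> cmod z ^ N"
        using z \<rho> by (intro power_mono) (auto simp: A_def)
      then have "\<rho> ^ (2 * N) \<le> (cmod z ^ N)\<^sup>2"
        using \<rho> by (simp add: mult.commute[of 2] power_mult power_mono)
      then have "(Suc N * B powr (s - 2)) * \<rho> ^ (2 * N) \<le> (Suc N * B powr (s - 2)) * (cmod z ^ N)\<^sup>2"
        by (rule mult_left_mono) simp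
      then show ?thesis by (simp only: mult_ac)
    qed
    also have "\<dots> \<le> B powr (s - 2) * (\<Sum>j\<le>N. (cmod (poly Q (\<omega> ^ j * z)))\<^sup>2)"
      using monic_poly_roots_unity_mean_square[OF lc, of z] unfolding N_def \<omega>_def
      by (intro mult_left_mono) auto
    also have "\<dots> \<le> (\<Sum>j\<le>N. cmod (poly Q (\<omega> ^ j * z)) powr s)"
      unfolding sum_distrib_left using z
      by (intro sum_mono sq B) (auto simp: A_def norm_mult w)
    finally show ?thesis .
  qed
  have "emeasure lborel A = ennreal (pi * \<sigma>\<^sup>2) - ennreal (pi * \<rho>\<^sup>2)"
    unfolding A_def using \<rho>
    by (subst emeasure_Diff) (auto simp: emeasure_ball_complex)
  also have "\<dots> = ennreal (pi * (\<sigma>\<^sup>2 - \<rho>\<^sup>2))"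
    using \<rho> by (simp add: ennreal_minus right_diff_distrib)
  finally have area: "emeasure lborel A = ennreal (pi * (\<sigma>\<^sup>2 - \<rho>\<^sup>2))" .
  have "ennreal (Suc N) * ennreal (B powr (s - 2) * \<rho> ^ (2 * N) * (pi * (\<sigma>\<^sup>2 - \<rho>\<^sup>2)))
    = ennreal (Suc N * (B powr (s - 2) * \<rho> ^ (2 * N))) * emeasure lborel A"
  proof -
    have "ennreal a * ennreal (b * c) = ennreal (a * b) * ennreal c" if "0 \<le> a" "0 \<le> b" for a b c
      using that by (simp add: ennreal_mult' mult.assoc)
    from this[of "Suc N" "B powr (s - 2) * \<rho> ^ (2 * N)"] show ?thesis
      unfolding area using \<rho>(1) by (simp only: of_nat_0_le_iff powr_ge_zero zero_le_power mult_nonneg_nonneg simp_thms)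
  qed
  also have "\<dots> = (\<integral>\<^sup>+z\<in>A. ennreal (Suc N * (B powr (s - 2) * \<rho> ^ (2 * N))) \<partial>lborel)"
    by (rule nn_integral_cmult_indicator[symmetric]) simp
  \<comment> \<open>The annulus is invariant under each rotation and so is area, so the N + 1
    summands have equal integrals; the factor N + 1 is cancelled at the end.\<close>
  also have "\<dots> \<le> (\<integral>\<^sup>+z. (\<Sum>j\<le>N. ennreal (cmod (poly Q (\<omega> ^ j * z)) powr s) * indicator A (\<omega> ^ j * z)) \<partial>lborel)"
  proof (intro nn_integral_mono)
    fix z
    show "ennreal (Suc N * (B powr (s - 2) * \<rho> ^ (2 * N))) * indicator A z \<le>
        (\<Sum>j\<le>N. ennreal (cmod (poly Q (\<omega> ^ j * z)) powr s) * indicator A (\<omega> ^ j * z))"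
      using pw[of z] by (cases "z \<in> A") (simp_all add: A_rot[OF w] sum_ennreal ennreal_leI del: of_nat_Suc)
  qed
  also have "\<dots> = (\<Sum>j\<le>N. \<integral>\<^sup>+z. ennreal (cmod (poly Q (\<omega> ^ j * z)) powr s) * indicator A (\<omega> ^ j * z) \<partial>lborel)"
    by (rule nn_integral_sum) measurable
  also have "\<dots> = (\<Sum>j\<le>N. \<integral>\<^sup>+z\<in>A. ennreal (cmod (poly Q z) powr s) \<partial>lborel)"
    by (intro sum.cong refl nn_integral_rotate[OF _ w]) measurable
  also have "\<dots> = ennreal (Suc N) * (\<integral>\<^sup>+z\<in>A. ennreal (cmod (poly Q z) powr s) \<partial>lborel)"
    by (simp add: ennreal_of_nat_eq_real_of_nat)
  finally show ?thesis
    using ennreal_mult_le_mult_iff[of "ennreal (Suc N)"] unfolding A_def N_def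
    by (simp only: ennreal_neq_top ennreal_eq_0_iff not_False_eq_True)
qed

section \<open>Contribution of one annulus\<close>

text \<open>From x + y \<le> 2 max(x, y). The crude constant serves the convex range s \<ge> 1 and
  the concave range s < 1 alike.\<close>

lemma powr_add_le:
  fixes x y s :: real
  assumes "0 \<le> x" "0 \<le> y" "0 < s"
  shows "(x + y) powr s \<le> 2 powr s * (x powr s + y powr s)"
proof -
  have "(x + y) powr s \<le> (2 * max x y) powr s"
    using assms by (intro powr_mono2) auto
  also have "\<dots> = 2 powr s * max x y powr s"
    using assms by (simp add: powr_mult)
  also have "max x y powr s \<le> x powr s + y powr s"
    by (simp add: max_def)
  finally show ?thesis by simp
qed

text \<open>Here |g| is at most \<open>M\<close> plus a B n |z|^(n-1). After splitting the power,
  the integral of the first term is enlarged to all of |z| \<ge> \<rho>, where \<open>tail\<close>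
  applies, and that of the second to the whole disc, where the kernel bound is uniform in
  \<open>n\<close>.\<close>

lemma annulus_integral_upper:
  fixes g Q :: "complex \<Rightarrow> complex" and n :: nat
  assumes s: "0 < s" and n: "1 \<le> n" and c: "0 \<le> a" "0 \<le> B" "0 \<le> M" "0 \<le> T" and \<sigma>: "\<sigma> \<le> 1"
    and Q: "\<And>z. cmod z \<le> 1 \<Longrightarrow> cmod (Q z) \<le> B"
    and g: "\<And>z. \<rho> \<le> cmod z \<Longrightarrow> cmod z < \<sigma> \<Longrightarrow>
      cmod (g z - complex_of_real a * of_nat n * z ^ (n - 1) * Q z) \<le> M"
    and tail: "ennreal (M powr s) *
      (\<integral>\<^sup>+z\<in>ball 0 1 - ball 0 \<rho>. ennreal ((1 - cmod z) powr (s - 1)) \<partial>lborel) \<le> ennreal T"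
  shows "(\<integral>\<^sup>+z\<in>ball 0 \<sigma> - ball 0 \<rho>. ennreal ((1 - cmod z) powr (s - 1) * cmod (g z) powr s) \<partial>lborel)
    \<le> ennreal (2 powr s * (T + (a * B) powr s * disc_kernel_bound s))"
proof -
  let ?w = "\<lambda>z. (1 - cmod z) powr (s - 1)"
  let ?X = "\<lambda>z. ennreal (M powr s) * (ennreal (?w z) * indicator (ball 0 1 - ball 0 \<rho>) z)"
  let ?Y = "\<lambda>z. ennreal ((a * B) powr s) *
    (ennreal (?w z * (n * cmod z ^ (n - 1)) powr s) * indicator (ball 0 1) z)"
  have pw: "ennreal (?w z * cmod (g z) powr s) * indicator (ball 0 \<sigma> - ball 0 \<rho>) z \<le>
      ennreal (2 powr s) * (?X z + ?Y z)" for z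
  proof (cases "z \<in> ball 0 \<sigma> - ball 0 \<rho>")
    case True
    then have z: "\<rho> \<le> cmod z" "cmod z < \<sigma>" "cmod z < 1" using \<sigma> by auto
    have "cmod (g z) \<le> M + a * n * cmod z ^ (n - 1) * cmod (Q z)"
      using g[OF z(1,2)] norm_triangle_sub[of "g z" "complex_of_real a * of_nat n * z ^ (n - 1) * Q z"] c
      by (simp add: norm_mult norm_power)
    also have "\<dots> \<le> M + a * n * cmod z ^ (n - 1) * B"
      using Q[of z] z c by (intro add_mono mult_left_mono) auto
    finally have "cmod (g z) \<le> M + (a * B) * (n * cmod z ^ (n - 1))"
      by (simp add: mult_ac)
    then have "cmod (g z) powr s \<le> (M + (a * B) * (n * cmod z ^ (n - 1))) powr s"
      using s by (intro powr_mono2) auto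
    also have "\<dots> \<le> 2 powr s * (M powr s + ((a * B) * (n * cmod z ^ (n - 1))) powr s)"
      using s c by (intro powr_add_le) auto
    also have "((a * B) * (n * cmod z ^ (n - 1))) powr s = (a * B) powr s * (n * cmod z ^ (n - 1)) powr s"
      by (rule powr_mult)
    finally have "?w z * cmod (g z) powr s \<le>
        ?w z * (2 powr s * (M powr s + (a * B) powr s * (n * cmod z ^ (n - 1)) powr s))"
      by (rule mult_left_mono) simp
    also have "\<dots> = 2 powr s * (M powr s * ?w z + (a * B) powr s * (?w z * (n * cmod z ^ (n - 1)) powr s))"
      by (simp add: algebra_simps)
    finally have "ennreal (?w z * cmod (g z) powr s) \<le>
        ennreal (2 powr s * (M powr s * ?w z + (a * B) powr s * (?w z * (n * cmod z ^ (n - 1)) powr s)))"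
      by (rule ennreal_leI)
    also have "\<dots> = ennreal (2 powr s) * (?X z + ?Y z)"
      using z by (simp add: ennreal_mult' ennreal_plus)
    finally show ?thesis using True by simp
  qed simp
  have "(\<integral>\<^sup>+z\<in>ball 0 \<sigma> - ball 0 \<rho>. ennreal (?w z * cmod (g z) powr s) \<partial>lborel) \<le>
      (\<integral>\<^sup>+z. ennreal (2 powr s) * (?X z + ?Y z) \<partial>lborel)"
    by (intro nn_integral_mono pw)
  also have "\<dots> = ennreal (2 powr s) * ((\<integral>\<^sup>+z. ?X z \<partial>lborel) + (\<integral>\<^sup>+z. ?Y z \<partial>lborel))"
    by (simp add: nn_integral_cmult nn_integral_add)
  also have "(\<integral>\<^sup>+z. ?X z \<partial>lborel) = ennreal (M powr s) *
      (\<integral>\<^sup>+z\<in>ball 0 1 - ball 0 \<rho>. ennreal (?w z) \<partial>lborel)"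
    by (rule nn_integral_cmult) measurable
  also have "(\<integral>\<^sup>+z. ?Y z \<partial>lborel) = ennreal ((a * B) powr s) *
      (\<integral>\<^sup>+z\<in>ball 0 1. ennreal (?w z * (n * cmod z ^ (n - 1)) powr s) \<partial>lborel)"
    by (rule nn_integral_cmult) measurable
  also have "ennreal (2 powr s) *
      (ennreal (M powr s) * (\<integral>\<^sup>+z\<in>ball 0 1 - ball 0 \<rho>. ennreal (?w z) \<partial>lborel) +
       ennreal ((a * B) powr s) *
        (\<integral>\<^sup>+z\<in>ball 0 1. ennreal (?w z * (n * cmod z ^ (n - 1)) powr s) \<partial>lborel)) \<le>
       ennreal (2 powr s) * (ennreal T + ennreal ((a * B) powr s) * ennreal (disc_kernel_bound s))"
    using disc_kernel_bound[OF s n] tail by (intro mult_left_mono add_mono) auto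
  also have "\<dots> = ennreal (2 powr s * (T + (a * B) powr s * disc_kernel_bound s))"
    using c disc_kernel_bound_pos[OF s] by (simp add: ennreal_mult' ennreal_plus)
  finally show ?thesis .
qed

text \<open>Only the subannulus \<open>A\<close>, at distance between 1/n and 2/n from the unit
  circle, is used. On it the weight is at least of order n^(1-s), the power of |z| is bounded below,
  and the area is of order 1/n, so all powers of \<open>n\<close> cancel.\<close>

lemma annulus_integral_lower:
  fixes g :: "complex \<Rightarrow> complex" and Q :: "complex poly" and n :: nat
  assumes [measurable]: "g \<in> borel_measurable borel"
    and s: "0 < s" "s \<le> 2" and n: "3 \<le> n" and c: "0 < a" "0 < B" "0 \<le> M"
    and lc: "lead_coeff Q = 1"
    and \<rho>: "\<rho> \<le> 1 - 2 / n" and \<sigma>: "1 - 1 / n \<le> \<sigma>" "\<sigma> \<le> 1"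
    and Q: "\<And>z. cmod z \<le> 1 \<Longrightarrow> cmod (poly Q z) \<le> B"
    and pow: "1 / 2 \<le> (1 - 2 / n) ^ degree Q" "exp (- 3) \<le> (1 - 2 / n) ^ n"
    and g: "\<And>z. \<rho> \<le> cmod z \<Longrightarrow> cmod z < \<sigma> \<Longrightarrow>
      cmod (g z - complex_of_real a * of_nat n * z ^ (n - 1) * poly Q z) \<le> M"
    and tail: "ennreal (M powr s) *
      (\<integral>\<^sup>+z\<in>ball 0 1 - ball 0 \<rho>. ennreal ((1 - cmod z) powr (s - 1)) \<partial>lborel) \<le> ennreal T"
  shows "ennreal (pi / 8 * exp (- 3 * s) * B powr (s - 2) * a powr s) \<le> ennreal (2 powr s) *
    ((\<integral>\<^sup>+z\<in>ball 0 \<sigma> - ball 0 \<rho>. ennreal ((1 - cmod z) powr (s - 1) * cmod (g z) powr s) \<partial>lborel) + ennreal T)"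
proof -
  let ?w = "\<lambda>z. (1 - cmod z) powr (s - 1)"
  let ?X = "\<lambda>z. ennreal (?w z * cmod (g z) powr s) * indicator (ball 0 \<sigma> - ball 0 \<rho>) z"
  let ?Y = "\<lambda>z. ennreal (M powr s) * (ennreal (?w z) * indicator (ball 0 1 - ball 0 \<rho>) z)"
  define A :: "complex set" where "A = ball 0 (1 - 1 / n) - ball 0 (1 - 2 / n)"
  \<comment> \<open>The product of the weight bound n^(1-s)/2 and (a n e^(-3))^s.\<close>
  define K where "K = 1 / 2 * n * a powr s * exp (- 3 * s)"
  have K: "K \<ge> 0" by (simp add: K_def)
  have [measurable]: "A \<in> sets borel" by (simp add: A_def)
  have [measurable]: "poly Q \<in> borel_measurable borel"
    by (intro borel_measurable_continuous_onI continuous_intros)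
  have n0: "0 < real n" using n by simp
  have pw: "ennreal K * (ennreal (cmod (poly Q z) powr s) * indicator A z) \<le>
      ennreal (2 powr s) * (?X z + ?Y z)" for z
  proof (cases "z \<in> A")
    case True
    then have z: "1 - 2 / n \<le> cmod z" "cmod z < 1 - 1 / n" by (auto simp: A_def)
    moreover have "0 < 1 / real n" using n0 by simp
    ultimately have z': "\<rho> \<le> cmod z" "cmod z < \<sigma>" "cmod z < 1" using \<rho> \<sigma> by linarith+
    \<comment> \<open>For s \<ge> 1 the weight is least as 1 - |z| approaches 1/n; for s < 1 it is
      least at 1 - |z| = 2/n, which costs 2^(s-1) \<ge> 1/2.\<close>
    have w: "1 / 2 * (1 / n) powr (s - 1) \<le> ?w z"
    proof (cases "s \<ge> 1")
      case True
      have "1 / 2 * (1 / n) powr (s - 1) \<le> (1 / n) powr (s - 1)" by simp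
      also have "\<dots> \<le> ?w z" using True z n0 by (intro powr_mono2) auto
      finally show ?thesis .
    next
      case False
      have "1 / 2 = 2 powr (- 1 :: real)" by (simp add: powr_minus)
      also have "\<dots> \<le> 2 powr (s - 1)" using s by (intro powr_mono) auto
      finally have "1 / 2 * (1 / n) powr (s - 1) \<le> 2 powr (s - 1) * (1 / n) powr (s - 1)"
        by (rule mult_right_mono) simp
      also have "\<dots> = (2 / n) powr (s - 1)"
        by (subst powr_mult[symmetric]) auto
      also have "\<dots> \<le> ?w z" using False z z' by (intro powr_mono2') auto
      finally show ?thesis .
    qed
    have "0 \<le> 1 - 2 / real n" using n by simp
    have "exp (- 3) \<le> (1 - 2 / n) ^ n" by (rule pow)
    also have "\<dots> \<le> cmod z ^ n" using z \<open>0 \<le> 1 - 2 / real n\<close> by (intro power_mono) auto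
    also have "\<dots> \<le> cmod z ^ (n - 1)" using z' by (intro power_decreasing) auto
    finally have e: "exp (- 3) \<le> cmod z ^ (n - 1)" .
    define m where "m = a * n * cmod z ^ (n - 1) * cmod (poly Q z)"
    have "K * cmod (poly Q z) powr s =
        (1 / 2 * (1 / n) powr (s - 1)) * (a * n * exp (- 3) * cmod (poly Q z)) powr s"
      using n0 c by (simp add: K_def powr_mult powr_divide powr_diff exp_powr_real)
    also have "\<dots> \<le> ?w z * m powr s"
      unfolding m_def using c e s
      by (intro mult_mono w powr_mono2 mult_right_mono mult_left_mono) auto
    also have "m powr s \<le> 2 powr s * (cmod (g z) powr s + M powr s)"
    proof -
      have "m \<le> cmod (g z) + M"
        using g[OF z'(1,2)] norm_triangle_sub[of "complex_of_real a * of_nat n * z ^ (n - 1) * poly Q z" "g z"] c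
        by (simp add: norm_mult norm_power m_def norm_minus_commute)
      then have "m powr s \<le> (cmod (g z) + M) powr s"
        using s c by (intro powr_mono2) (auto simp: m_def)
      also have "\<dots> \<le> 2 powr s * (cmod (g z) powr s + M powr s)"
        using s c by (intro powr_add_le) auto
      finally show ?thesis .
    qed
    finally have "K * cmod (poly Q z) powr s \<le> ?w z * (2 powr s * (cmod (g z) powr s + M powr s))"
      by (simp add: mult_left_mono)
    also have "\<dots> = 2 powr s * (?w z * cmod (g z) powr s + M powr s * ?w z)"
      by (simp add: algebra_simps)
    finally have "ennreal (K * cmod (poly Q z) powr s) \<le>
        ennreal (2 powr s * (?w z * cmod (g z) powr s + M powr s * ?w z))"
      by (rule ennreal_leI)
    also have "\<dots> = ennreal (2 powr s) * (?X z + ?Y z)"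
      using z' by (simp add: ennreal_mult' ennreal_plus)
    finally show ?thesis using True K by (simp add: ennreal_mult')
  qed simp
  have nn: "0 \<le> 1 - 2 / real n" "1 - 2 / real n \<le> 1 - 1 / real n"
    using n by (simp_all add: divide_right_mono)
  have "pi / 8 * exp (- 3 * s) * B powr (s - 2) * a powr s =
      K * (B powr (s - 2) * (1 / 4) * (pi * (1 / n)))"
    using n0 by (simp add: K_def)
  also have "\<dots> \<le> K * (B powr (s - 2) * (1 - 2 / n) ^ (2 * degree Q) * (pi * ((1 - 1 / n)\<^sup>2 - (1 - 2 / n)\<^sup>2)))"
  proof (intro mult_left_mono mult_mono K)
    have "(1 / 2)\<^sup>2 \<le> ((1 - 2 / real n) ^ degree Q)\<^sup>2"
      using pow(1) by (intro power_mono) auto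
    then show "1 / 4 \<le> (1 - 2 / real n) ^ (2 * degree Q)"
      by (simp add: power2_eq_square mult_2 power_add)
    \<comment> \<open>The difference of squares is 2/n - 3/n^2, which is at least 1/n exactly when n
      \<ge> 3.\<close>
    have "(1 - 1 / real n)\<^sup>2 - (1 - 2 / real n)\<^sup>2 - 1 / n = (real n - 3) / (real n)\<^sup>2"
      using n0 by (simp add: power2_eq_square field_simps)
    moreover have "0 \<le> (real n - 3) / (real n)\<^sup>2" using n by simp
    ultimately show "1 / n \<le> (1 - 1 / real n)\<^sup>2 - (1 - 2 / real n)\<^sup>2" by linarith
  qed (use nn in auto)
  finally have "ennreal (pi / 8 * exp (- 3 * s) * B powr (s - 2) * a powr s) \<le> ennreal \<dots>"
    by (rule ennreal_leI)
  also have "\<dots> = ennreal K * ennreal (B powr (s - 2) * (1 - 2 / n) ^ (2 * degree Q) * (pi * ((1 - 1 / n)\<^sup>2 - (1 - 2 / n)\<^sup>2)))"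
    using K by (rule ennreal_mult')
  also have "\<dots> \<le> ennreal K * (\<integral>\<^sup>+z\<in>A. ennreal (cmod (poly Q z) powr s) \<partial>lborel)"
    unfolding A_def
  proof (intro mult_left_mono nn_integral_annulus_monic_poly lc c s nn)
    fix z :: complex
    assume "cmod z < 1 - 1 / n"
    moreover have "0 < 1 / real n" using n0 by simp
    ultimately show "cmod (poly Q z) \<le> B" by (intro Q) linarith
  qed simp
  also have "\<dots> = (\<integral>\<^sup>+z. ennreal K * (ennreal (cmod (poly Q z) powr s) * indicator A z) \<partial>lborel)"
    by (rule nn_integral_cmult[symmetric]) measurable
  also have "\<dots> \<le> (\<integral>\<^sup>+z. ennreal (2 powr s) * (?X z + ?Y z) \<partial>lborel)"
    by (intro nn_integral_mono pw)
  also have "\<dots> = ennreal (2 powr s) * ((\<integral>\<^sup>+z. ?X z \<partial>lborel) + (\<integral>\<^sup>+z. ?Y z \<partial>lborel))"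
    by (subst nn_integral_cmult, measurable, subst nn_integral_add) measurable
  also have "(\<integral>\<^sup>+z. ?Y z \<partial>lborel) = ennreal (M powr s) *
      (\<integral>\<^sup>+z\<in>ball 0 1 - ball 0 \<rho>. ennreal (?w z) \<partial>lborel)"
    by (rule nn_integral_cmult) measurable
  also have "ennreal (2 powr s) * ((\<integral>\<^sup>+z. ?X z \<partial>lborel) +
      ennreal (M powr s) * (\<integral>\<^sup>+z\<in>ball 0 1 - ball 0 \<rho>. ennreal (?w z) \<partial>lborel)) \<le>
       ennreal (2 powr s) * ((\<integral>\<^sup>+z. ?X z \<partial>lborel) + ennreal T)"
    using tail by (intro mult_left_mono add_mono) auto
  finally show ?thesis .
qed

section \<open>The Rudin--Shapiro construction\<close>

text \<open>For real \<open>a\<close> the map (u, v) to (u + a v, v - a u) is an isometry up to the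
  factor sqrt(1 + a^2), as the cross terms cancel. It is applied to u = P and v = w Q.\<close>

lemma rudin_shapiro_step:
  fixes P Q w :: complex and a :: real
  assumes "cmod w \<le> 1"
  shows "(cmod (P + a * w * Q))\<^sup>2 + (cmod (w * Q - a * P))\<^sup>2 \<le> (1 + a\<^sup>2) * ((cmod P)\<^sup>2 + (cmod Q)\<^sup>2)"
proof -
  have "(cmod (P + a * w * Q))\<^sup>2 + (cmod (w * Q - a * P))\<^sup>2 = (1 + a\<^sup>2) * ((cmod P)\<^sup>2 + (cmod (w * Q))\<^sup>2)"
    unfolding cmod_power2 by (simp add: power2_eq_square algebra_simps)
  also have "\<dots> \<le> (1 + a\<^sup>2) * ((cmod P)\<^sup>2 + (cmod Q)\<^sup>2)"
    using assms by (intro mult_left_mono add_left_mono power_mono) (auto simp: norm_mult mult_left_le_one_le)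
  finally show ?thesis .
qed

text \<open>The order of choice is what matters. Given the polynomials of stage \<open>k\<close>,
  \<open>M k\<close> bounds their derivatives; then \<open>r k\<close> is so near 1 that an error
  \<open>M k\<close> beyond it costs only a geometric term; then \<open>n k\<close> is so large that
  the next summand is negligible inside \<open>r k\<close>.\<close>

lemma rudin_shapiro_choice:
  fixes a :: "nat \<Rightarrow> real" and S :: "real set"
  assumes a: "\<And>k. 0 < a k" "\<And>k. a k \<le> 1"
    and B: "B \<ge> 1" "\<And>k. (\<Prod>j<k. 1 + (a j)\<^sup>2) \<le> B\<^sup>2"
    and S: "finite S" "\<And>s. s \<in> S \<Longrightarrow> s > 0"
  obtains P Q :: "nat \<Rightarrow> complex poly" and r M :: "nat \<Rightarrow> real" and n :: "nat \<Rightarrow> nat"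
  where "P 0 = 0" "\<And>k. P (Suc k) = P k + smult (a k) (monom 1 (n k) * Q k)"
    and "\<And>k. lead_coeff (Q k) = 1"
    and "\<And>k z. cmod z \<le> 1 \<Longrightarrow> cmod (poly (P k) z) \<le> B"
    and "\<And>k z. cmod z \<le> 1 \<Longrightarrow> cmod (poly (Q k) z) \<le> B"
    and "\<And>k z. cmod z \<le> 1 \<Longrightarrow> cmod (poly (pderiv (P k)) z) + cmod (poly (pderiv (Q k)) z) + 1 \<le> M k"
    and "r 0 = 0" "\<And>k. 0 \<le> r k" "\<And>k. r k < 1"
    and "\<And>k. r k \<le> 1 - 2 / n k" "\<And>k. 1 - 1 / n k \<le> r (Suc k)"
    and "\<And>k. k + 3 \<le> n k" "\<And>k. M k \<le> n k"
    and "\<And>k. n k * r k ^ (n k - 1) * (B + 1) \<le> (1/2) ^ Suc k"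
    and "\<And>k. 1 / 2 \<le> (1 - 2 / n k) ^ degree (Q k)" "\<And>k. exp (- 3) \<le> (1 - 2 / n k) ^ n k"
    and "\<And>k s. s \<in> S \<Longrightarrow>
      ennreal (M k powr s) * (\<integral>\<^sup>+z\<in>ball 0 1 - ball 0 (r k). ennreal ((1 - cmod z) powr (s - 1)) \<partial>lborel)
        \<le> ennreal (disc_kernel_bound s * (1/2) ^ k)"
proof -
  define tail where "tail M r k \<longleftrightarrow> (\<forall>s\<in>S. ennreal (M powr s) *
      (\<integral>\<^sup>+z\<in>ball 0 1 - ball 0 r. ennreal ((1 - cmod z) powr (s - 1)) \<partial>lborel)
        \<le> ennreal (disc_kernel_bound s * (1/2) ^ k))" for M r :: real and k :: nat
  define size where "size P Q k \<longleftrightarrow> (\<forall>z. cmod z \<le> 1 \<longrightarrow>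
      (cmod (poly P z))\<^sup>2 + (cmod (poly Q z))\<^sup>2 \<le> (\<Prod>j<k. 1 + (a j)\<^sup>2))" for P Q :: "complex poly" and k
  define dbound where "dbound P Q M \<longleftrightarrow> (\<forall>z. cmod z \<le> 1 \<longrightarrow>
      cmod (poly (pderiv P) z) + cmod (poly (pderiv Q) z) + 1 \<le> M)" for P Q :: "complex poly" and M
  \<comment> \<open>The condition on \<open>degree P\<close> keeps the next Q monic, the one with
    \<open>B + 1\<close> makes the derivative of the new summand small on |z| \<le> r, and the last
    two serve the lower bound on the annulus.\<close>
  define freq where "freq P Q r M n k \<longleftrightarrow> k + 3 \<le> n \<and> degree P < n \<and> M \<le> n \<and> r \<le> 1 - 2 / n \<and>
      n * r ^ (n - 1) * (B + 1) \<le> (1/2) ^ Suc k \<and>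
      1 / 2 \<le> (1 - 2 / n) ^ degree Q \<and> exp (- 3) \<le> (1 - 2 / n) ^ n"
    for P Q :: "complex poly" and r M :: real and n k :: nat

  have ex_freq: "\<exists>n. freq P Q r M n k" if r: "0 \<le> r" "r < 1" for P Q r M k
  proof -
    have "(\<lambda>n. 1 - 2 / real n) \<longlonglongrightarrow> 1 - 0"
      by (intro tendsto_intros lim_const_over_n)
    then have lim: "(\<lambda>n. 1 - 2 / real n) \<longlonglongrightarrow> 1" by simp
    have "(\<lambda>n. (1 - 2 / real n) ^ degree Q) \<longlonglongrightarrow> 1 ^ degree Q"
      by (intro tendsto_power lim)
    then have e1: "\<forall>\<^sub>F n in sequentially. 1 / 2 < (1 - 2 / real n) ^ degree Q"
      by (rule order_tendstoD) simp
    have "(\<lambda>n. (1 + (- 2) / real n) ^ n) \<longlonglongrightarrow> exp (- 2)"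
      by (rule tendsto_exp_limit_sequentially)
    \<comment> \<open>The limit is e^(-2), so e^(-3) leaves room.\<close>
    then have e2: "\<forall>\<^sub>F n in sequentially. exp (- 3) < (1 + (- 2) / real n) ^ n"
      by (rule order_tendstoD) simp
    have "(\<lambda>n. real n * r ^ n + r ^ n) \<longlonglongrightarrow> 0 + 0"
      using r by (intro tendsto_add powser_times_n_limit_0 LIMSEQ_power_zero) auto
    then have "(\<lambda>n. real (Suc n) * r ^ (Suc n - 1)) \<longlonglongrightarrow> 0"
      by (simp add: algebra_simps)
    then have "(\<lambda>n. real n * r ^ (n - 1)) \<longlonglongrightarrow> 0"
      by (rule LIMSEQ_imp_Suc)
    then have "(\<lambda>n. real n * r ^ (n - 1) * (B + 1)) \<longlonglongrightarrow> 0"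
      by (rule tendsto_mult_left_zero)
    then have e3: "\<forall>\<^sub>F n in sequentially. real n * r ^ (n - 1) * (B + 1) < (1/2) ^ Suc k"
      by (rule order_tendstoD) simp
    have e4: "\<forall>\<^sub>F n in sequentially. r < 1 - 2 / real n"
      using lim r(2) by (rule order_tendstoD)
    have "\<forall>\<^sub>F n in sequentially. freq P Q r M n k"
      using e1 e2 e3 e4 eventually_ge_at_top[of "k + 3"] eventually_gt_at_top[of "degree P"]
        eventually_ge_at_top[of "nat \<lceil>M\<rceil>"]
    proof eventually_elim
      case (elim n)
      then show ?case by (simp add: freq_def)
    qed
    then show ?thesis by (auto dest: eventually_happens)
  qed

  have ex_dbound: "\<exists>M. dbound P Q M" for P Q
  proof -
    have "bounded ((\<lambda>z. cmod (poly (pderiv P) z) + cmod (poly (pderiv Q) z) + 1) ` cball 0 1)"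
      by (intro compact_imp_bounded compact_continuous_image continuous_intros compact_cball)
    then obtain M where "\<forall>x\<in>(\<lambda>z. cmod (poly (pderiv P) z) + cmod (poly (pderiv Q) z) + 1) ` cball 0 1. norm x \<le> M"
      by (auto simp: bounded_iff)
    then show ?thesis unfolding dbound_def by (intro exI[of _ M]) fastforce
  qed

  have ex_tail: "\<exists>r. 0 \<le> r \<and> r < 1 \<and> c \<le> r \<and> tail M r k" if "c < 1" for c M k
  proof -
    have "\<forall>\<^sub>F r in at_left 1. \<forall>s\<in>S. ennreal (M powr s) *
      (\<integral>\<^sup>+z\<in>ball 0 1 - ball 0 r. ennreal ((1 - cmod z) powr (s - 1)) \<partial>lborel)
        \<le> ennreal (disc_kernel_bound s * (1/2) ^ k)"
      using S by (intro eventually_ball_finite ballI eventually_weight_tail_small)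
        (auto simp: disc_kernel_bound_pos)
    moreover have "\<forall>\<^sub>F r in at_left 1. r \<in> {max 0 c<..<1}"
      using that by (intro eventually_at_left_real) simp
    ultimately have "\<forall>\<^sub>F r in at_left 1. 0 \<le> r \<and> r < 1 \<and> c \<le> r \<and> tail M r k"
      by eventually_elim (auto simp: tail_def)
    then show ?thesis
      using eventually_happens[of _ "at_left (1::real)"] trivial_limit_at_left_real by blast
  qed

  define Inv where "Inv k x \<longleftrightarrow> (case x of (P, Q, r, M, n) \<Rightarrow>
      (k = 0 \<longrightarrow> P = 0 \<and> r = 0) \<and> lead_coeff Q = 1 \<and> size P Q k \<and> dbound P Q M \<and>
      0 \<le> r \<and> r < 1 \<and> tail M r k \<and> freq P Q r M n k)" for k and x :: "complex poly \<times> complex poly \<times> real \<times> real \<times> nat"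
  define Step where "Step k x y \<longleftrightarrow> (case (x, y) of ((P, Q, r, M, n), (P', Q', r', M', n')) \<Rightarrow>
      P' = P + smult (a k) (monom 1 n * Q) \<and> 1 - 1 / n \<le> r')"
    for k and x y :: "complex poly \<times> complex poly \<times> real \<times> real \<times> nat"

  have "\<exists>x. Inv 0 x"
  proof -
    obtain n where "freq 0 1 0 1 n 0" using ex_freq[of 0 0 1 1 0] by auto
    \<comment> \<open>At k = 0 the geometric factor is 1 and the region is the whole disc, so the
      total weight must be at most \<open>disc_kernel_bound s\<close>: this is the kernel estimate
      for n = 1.\<close>
    moreover have "tail 1 0 0"
      using S weight_integral_le by (auto simp: tail_def)
    ultimately have "Inv 0 (0, 1, 0, 1, n)"
      by (simp add: Inv_def size_def dbound_def)
    then show ?thesis by blast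
  qed
  moreover have "\<exists>y. Inv (Suc k) y \<and> Step k x y" if "Inv k x" for x k
  proof -
    obtain P Q r M n where x: "x = (P, Q, r, M, n)" by (cases x)
    define P' Q' where "P' = P + smult (a k) (monom 1 n * Q)"
      and "Q' = monom 1 n * Q - smult (a k) P"
    have inv: "lead_coeff Q = 1" "size P Q k" "freq P Q r M n k"
      using that by (auto simp: Inv_def x)
    then have n: "degree P < n" "n \<ge> 3" by (auto simp: freq_def)
    obtain M' where M': "dbound P' Q' M'" using ex_dbound by blast
    obtain r' where r': "0 \<le> r'" "r' < 1" "1 - 1 / n \<le> r'" "tail M' r' (Suc k)"
      using ex_tail[of "1 - 1 / n" M' "Suc k"] n by auto
    obtain n' where n': "freq P' Q' r' M' n' (Suc k)"
      using ex_freq r' by blast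
    have "lead_coeff Q' = 1"
    proof -
      have Q0: "Q \<noteq> 0" using inv by auto
      then have "degree (monom 1 n * Q) = n + degree Q"
        by (subst degree_mult_eq) (auto simp: degree_monom_eq)
      \<comment> \<open>The degree of P is below n, hence below that of z^n Q, and the leading term
        survives.\<close>
      then have "degree (- smult (a k) P) < degree (monom 1 n * Q)"
        using n(1) a(1)[of k] by simp
      then have "lead_coeff (- smult (a k) P + monom 1 n * Q) = lead_coeff (monom 1 n * Q)"
        by (rule lead_coeff_add_le)
      then show ?thesis
        using inv(1) by (simp add: Q'_def lead_coeff_mult degree_monom_eq)
    qed
    moreover have "size P' Q' (Suc k)"
      unfolding size_def
    proof (intro allI impI)
      fix z :: complex
      assume z: "cmod z \<le> 1"
      have "(cmod (poly P' z))\<^sup>2 + (cmod (poly Q' z))\<^sup>2 \<le>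
          (1 + (a k)\<^sup>2) * ((cmod (poly P z))\<^sup>2 + (cmod (poly Q z))\<^sup>2)"
        using rudin_shapiro_step[of "z ^ n" "poly P z" "a k" "poly Q z"] z
        by (simp add: P'_def Q'_def poly_monom norm_power power_le_one mult.assoc)
      also have "\<dots> \<le> (1 + (a k)\<^sup>2) * (\<Prod>j<k. 1 + (a j)\<^sup>2)"
        using inv(2) z by (intro mult_left_mono) (auto simp: size_def)
      finally show "(cmod (poly P' z))\<^sup>2 + (cmod (poly Q' z))\<^sup>2 \<le> (\<Prod>j<Suc k. 1 + (a j)\<^sup>2)"
        by (simp add: mult.commute)
    qed
    ultimately have "Inv (Suc k) (P', Q', r', M', n') \<and> Step k x (P', Q', r', M', n')"
      using M' r' n' by (simp add: Inv_def Step_def x P'_def)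
    then show ?thesis by blast
  qed
  ultimately obtain X where X: "\<And>k. Inv k (X k)" "\<And>k. Step k (X k) (X (Suc k))"
    using dependent_nat_choice[of Inv Step] by blast
  define P Q r M n where "P k = fst (X k)" and "Q k = fst (snd (X k))"
    and "r k = fst (snd (snd (X k)))" and "M k = fst (snd (snd (snd (X k))))"
    and "n k = snd (snd (snd (snd (X k))))" for k
  have X_eq: "X k = (P k, Q k, r k, M k, n k)" for k
    by (simp add: P_def Q_def r_def M_def n_def)
  have inv: "(k = 0 \<longrightarrow> P k = 0 \<and> r k = 0)" "lead_coeff (Q k) = 1" "size (P k) (Q k) k"
    "dbound (P k) (Q k) (M k)" "0 \<le> r k" "r k < 1" "tail (M k) (r k) k"
    "freq (P k) (Q k) (r k) (M k) (n k) k" for k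
    using X(1)[of k] by (simp_all add: Inv_def X_eq)
  have step: "P (Suc k) = P k + smult (a k) (monom 1 (n k) * Q k)" "1 - 1 / n k \<le> r (Suc k)" for k
    using X(2)[of k] by (simp_all add: Step_def X_eq)
  have bd: "cmod (poly (P k) z) \<le> B" "cmod (poly (Q k) z) \<le> B" if "cmod z \<le> 1" for k z
  proof -
    have "(cmod (poly (P k) z))\<^sup>2 + (cmod (poly (Q k) z))\<^sup>2 \<le> B\<^sup>2"
      using inv(3)[of k] B(2)[of k] that by (force simp: size_def)
    then have "(cmod (poly (P k) z))\<^sup>2 \<le> B\<^sup>2" "(cmod (poly (Q k) z))\<^sup>2 \<le> B\<^sup>2"
      by (smt (verit) zero_le_power2)+
    then show "cmod (poly (P k) z) \<le> B" "cmod (poly (Q k) z) \<le> B"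
      using B(1) by (auto intro: power2_le_imp_le)
  qed
  show ?thesis
    by (rule that[where P = P and Q = Q and r = r and M = M and n = n])
      (use inv step bd in \<open>auto simp: dbound_def freq_def tail_def\<close>)
qed

text \<open>The function is the limit of the P k. On the annulus with index \<open>k\<close> the
  derivative has three error terms: the earlier summands, giving the derivative of P k; the part of
  the current summand where Q k is differentiated; and the later summands, of total at most 1. The
  bound \<open>M k\<close> was made to cover their sum.\<close>

lemma bounded_function_with_annulus_estimate:
  fixes a :: "nat \<Rightarrow> real" and S :: "real set"
  assumes a: "\<And>k. 0 < a k" "\<And>k. a k \<le> 1"
    and B: "B \<ge> 1" "\<And>k. (\<Prod>j<k. 1 + (a j)\<^sup>2) \<le> B\<^sup>2"
    and S: "finite S" "\<And>s. s \<in> S \<Longrightarrow> s > 0"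
  obtains f :: "complex \<Rightarrow> complex" and Q :: "nat \<Rightarrow> complex poly"
    and r M :: "nat \<Rightarrow> real" and n :: "nat \<Rightarrow> nat"
  where "f holomorphic_on ball 0 1" "\<And>z. cmod z < 1 \<Longrightarrow> cmod (f z) \<le> B"
    and "\<And>k z. r k \<le> cmod z \<Longrightarrow> cmod z < r (Suc k) \<Longrightarrow>
      cmod (deriv f z - complex_of_real (a k) * of_nat (n k) * z ^ (n k - 1) * poly (Q k) z) \<le> M k"
    and "\<And>k. lead_coeff (Q k) = 1"
    and "\<And>k z. cmod z \<le> 1 \<Longrightarrow> cmod (poly (Q k) z) \<le> B"
    and "r 0 = 0" "\<And>k. r k < 1" "\<And>k. 0 < M k"
    and "\<And>k. r k \<le> 1 - 2 / n k" "\<And>k. 1 - 1 / n k \<le> r (Suc k)"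
    and "\<And>k. k + 3 \<le> n k"
    and "\<And>k. 1 / 2 \<le> (1 - 2 / n k) ^ degree (Q k)" "\<And>k. exp (- 3) \<le> (1 - 2 / n k) ^ n k"
    and "\<And>k s. s \<in> S \<Longrightarrow>
      ennreal (M k powr s) * (\<integral>\<^sup>+z\<in>ball 0 1 - ball 0 (r k). ennreal ((1 - cmod z) powr (s - 1)) \<partial>lborel)
        \<le> ennreal (disc_kernel_bound s * (1/2) ^ k)"
proof -
  obtain P Q :: "nat \<Rightarrow> complex poly" and r M :: "nat \<Rightarrow> real" and n :: "nat \<Rightarrow> nat"
  where P: "P 0 = 0" "\<And>k. P (Suc k) = P k + smult (a k) (monom 1 (n k) * Q k)"
    and lc: "\<And>k. lead_coeff (Q k) = 1"
    and bd: "\<And>k z. cmod z \<le> 1 \<Longrightarrow> cmod (poly (P k) z) \<le> B"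
      "\<And>k z. cmod z \<le> 1 \<Longrightarrow> cmod (poly (Q k) z) \<le> B"
    and M: "\<And>k z. cmod z \<le> 1 \<Longrightarrow> cmod (poly (pderiv (P k)) z) + cmod (poly (pderiv (Q k)) z) + 1 \<le> M k"
    and r: "r 0 = 0" "\<And>k. 0 \<le> r k" "\<And>k. r k < 1"
      "\<And>k. r k \<le> 1 - 2 / n k" "\<And>k. 1 - 1 / n k \<le> r (Suc k)"
    and n: "\<And>k. k + 3 \<le> n k" "\<And>k. M k \<le> n k"
      "\<And>k. n k * r k ^ (n k - 1) * (B + 1) \<le> (1/2) ^ Suc k"
      "\<And>k. 1 / 2 \<le> (1 - 2 / n k) ^ degree (Q k)" "\<And>k. exp (- 3) \<le> (1 - 2 / n k) ^ n k"
    and tail: "\<And>k s. s \<in> S \<Longrightarrow>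
      ennreal (M k powr s) * (\<integral>\<^sup>+z\<in>ball 0 1 - ball 0 (r k). ennreal ((1 - cmod z) powr (s - 1)) \<partial>lborel)
        \<le> ennreal (disc_kernel_bound s * (1/2) ^ k)"
  proof (rule rudin_shapiro_choice[OF a B S(1)], goal_cases)
    case (2 P n Q M r)
    show ?case by (rule 2(1)) (fact 2)+
  qed (rule S(2))
  define h where "h k z = complex_of_real (a k) * z ^ n k * poly (Q k) z" for k z
  define main where "main k z = complex_of_real (a k) * of_nat (n k) * z ^ (n k - 1) * poly (Q k) z" for k z
  define h' where "h' k z = main k z + complex_of_real (a k) * z ^ n k * poly (pderiv (Q k)) z" for k z
  have h: "(h k has_field_derivative h' k z) (at z)" for k z
    unfolding h_def h'_def main_def
    by (auto intro!: derivative_eq_intros simp: algebra_simps)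
  have M1: "M k \<ge> 1" for k
    using M[of 0 k] by (smt (verit) norm_ge_zero norm_zero)
  have P_sum: "poly (P k) z = (\<Sum>j<k. h j z)" for k z
    by (induction k) (simp_all add: P h_def poly_monom)
  have P'_sum: "poly (pderiv (P k)) z = (\<Sum>j<k. h' j z)" for k z
  proof (rule DERIV_unique)
    show "(poly (P k) has_field_derivative poly (pderiv (P k)) z) (at z)"
      by (rule poly_DERIV)
    have "((\<lambda>z. \<Sum>j<k. h j z) has_field_derivative (\<Sum>j<k. h' j z)) (at z)"
      by (intro DERIV_sum h)
    then show "(poly (P k) has_field_derivative (\<Sum>j<k. h' j z)) (at z)"
      by (simp add: P_sum[abs_def])
  qed
  \<comment> \<open>As \<open>n k \<ge> k\<close>, the series is dominated by a geometric one on
    smaller discs, which allows termwise differentiation.\<close>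
  have h_le: "cmod (h k z) \<le> B * \<rho> ^ k" if "cmod z \<le> \<rho>" "\<rho> < 1" for k z \<rho>
  proof -
    have "0 \<le> \<rho>" using that(1) norm_ge_zero order_trans by blast
    have "cmod (h k z) = a k * cmod z ^ n k * cmod (poly (Q k) z)"
      using a(1)[of k] by (simp add: h_def norm_mult norm_power)
    also have "\<dots> \<le> 1 * \<rho> ^ k * B"
    proof (intro mult_mono bd a(2))
      have "cmod z ^ n k \<le> \<rho> ^ n k" using that by (intro power_mono) auto
      also have "\<dots> \<le> \<rho> ^ k"
        using that n(1)[of k] \<open>0 \<le> \<rho>\<close> by (intro power_decreasing) auto
      finally show "cmod z ^ n k \<le> \<rho> ^ k" .
    qed (use that a(1)[of k] \<open>0 \<le> \<rho>\<close> in \<open>auto intro: less_imp_le\<close>)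
    finally show ?thesis by (simp add: mult.commute)
  qed
  have "\<exists>f f'. \<forall>z \<in> ball 0 1. ((\<lambda>k. h k z) sums f z) \<and> ((\<lambda>k. h' k z) sums f' z) \<and>
      (f has_field_derivative f' z) (at z)"
  proof (rule series_and_derivative_comparison_complex)
    fix z :: complex
    assume z: "z \<in> ball 0 1"
    \<comment> \<open>The midpoint of |z| and 1: the disc about \<open>z\<close> of radius \<rho> -
      |z| stays in |y| \<le> \<rho>.\<close>
    define \<rho> where "\<rho> = (1 + cmod z) / 2"
    have \<rho>: "0 \<le> \<rho>" "\<rho> < 1" using z by (auto simp: \<rho>_def)
    show "\<exists>d H. 0 < d \<and> summable H \<and> range H \<subseteq> \<real>\<^sub>\<ge>\<^sub>0 \<and>
        (\<forall>\<^sub>F k in sequentially. \<forall>y\<in>ball z d \<inter> ball 0 1. cmod (h k y) \<le> cmod (H k))"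
    proof (intro exI conjI always_eventually allI ballI)
      show "0 < \<rho> - cmod z" using z by (simp add: \<rho>_def field_simps)
      show "summable (\<lambda>k. complex_of_real (B * \<rho> ^ k))"
        using \<rho> by (intro summable_of_real summable_mult summable_geometric) auto
      show "range (\<lambda>k. complex_of_real (B * \<rho> ^ k)) \<subseteq> \<real>\<^sub>\<ge>\<^sub>0"
        using B \<rho> by (auto simp del: of_real_mult of_real_power)
      show "cmod (h k y) \<le> cmod (complex_of_real (B * \<rho> ^ k))"
        if y: "y \<in> ball z (\<rho> - cmod z) \<inter> ball 0 1" for k y
      proof -
        have "cmod y \<le> \<rho>"
          using y norm_triangle_sub[of y z] by (auto simp: dist_norm norm_minus_commute)
        then have "cmod (h k y) \<le> B * \<rho> ^ k" using \<rho> by (intro h_le)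
        also have "\<dots> \<le> cmod (complex_of_real (B * \<rho> ^ k))"
          by (simp only: norm_of_real abs_ge_self)
        finally show ?thesis .
      qed
    qed
  qed (auto intro: h)
  then obtain f f' where f: "\<And>z. cmod z < 1 \<Longrightarrow> (\<lambda>k. h k z) sums f z"
    "\<And>z. cmod z < 1 \<Longrightarrow> (\<lambda>k. h' k z) sums f' z"
    "\<And>z. cmod z < 1 \<Longrightarrow> (f has_field_derivative f' z) (at z)"
    by (auto simp: Ball_def)
  have r_mono: "r i \<le> r j" if "i \<le> j" for i j
  proof (rule lift_Suc_mono_le[OF _ that])
    fix k
    have "1 / real (n k) \<le> 2 / n k" by (simp add: divide_right_mono)
    then show "r k \<le> r (Suc k)" using r(4,5)[of k] by linarith
  qed
  \<comment> \<open>A summand whose annulus lies further out is negligible. Bounding the derivative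
    of Q k by M k \<le> n k gives both halves of h' the common factor n |z|^(n-1), whence
    \<open>B + 1\<close>.\<close>
  have h'_le: "cmod (h' k z) \<le> (1/2) ^ Suc k" if z: "cmod z \<le> r k" for k z
  proof -
    have z1: "cmod z \<le> 1" using z r(3)[of k] by simp
    have n1: "n k \<ge> 1" using n(1)[of k] by simp
    have "cmod (h' k z) \<le> a k * (n k * cmod z ^ (n k - 1) * B) + a k * (cmod z ^ n k * cmod (poly (pderiv (Q k)) z))"
      unfolding h'_def main_def using a(1)[of k] bd(2)[OF z1, of k]
      by (intro order_trans[OF norm_triangle_ineq] add_mono)
        (auto simp: norm_mult norm_power mult.assoc intro!: mult_left_mono)
    also have "\<dots> \<le> 1 * (n k * cmod z ^ (n k - 1) * B) + 1 * (cmod z ^ (n k - 1) * n k)"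
    proof (intro add_mono mult_mono a(2))
      show "cmod z ^ n k \<le> cmod z ^ (n k - 1)"
        using z1 by (intro power_decreasing) auto
      show "cmod (poly (pderiv (Q k)) z) \<le> n k"
        using M[OF z1, of k] n(2)[of k] norm_ge_zero[of "poly (pderiv (P k)) z"] by linarith
    qed (use a(1)[of k] B in \<open>auto intro: less_imp_le\<close>)
    also have "\<dots> = n k * cmod z ^ (n k - 1) * (B + 1)"
      by (simp add: algebra_simps)
    also have "\<dots> \<le> n k * r k ^ (n k - 1) * (B + 1)"
      using z B by (intro mult_right_mono mult_left_mono power_mono) auto
    also have "\<dots> \<le> (1/2) ^ Suc k" by (rule n(3))
    finally show ?thesis .
  qed
  have est: "cmod (deriv f z - main k z) \<le> M k" if z: "r k \<le> cmod z" "cmod z < r (Suc k)" for k z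
  proof -
    have z1: "cmod z < 1" using z r(3)[of "Suc k"] by simp
    \<comment> \<open>The later summands start at index \<open>Suc k\<close>, since |z| < r (Suc k)
      puts \<open>z\<close> inside all their radii.\<close>
    have g: "(\<lambda>j. (1/2::real) ^ Suc (j + Suc k)) sums ((1/2) ^ Suc k)"
      using sums_mult[OF geometric_sums[of "1/2::real"], of "(1/2) ^ Suc (Suc k)"]
      by (simp add: power_add mult_ac)
    have le: "cmod (h' (j + Suc k) z) \<le> (1/2) ^ Suc (j + Suc k)" for j
      using z r_mono[of "Suc k" "j + Suc k"] by (intro h'_le) simp
    have "(\<lambda>j. h' (j + Suc k) z) sums (f' z - (\<Sum>j<Suc k. h' j z))"
      by (rule sums_split_initial_segment[OF f(2)[OF z1]])
    then have "f' z - (\<Sum>j<Suc k. h' j z) = (\<Sum>j. h' (j + Suc k) z)"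
      by (simp add: sums_iff)
    also have "cmod \<dots> \<le> (\<Sum>j. (1/2) ^ Suc (j + Suc k))"
      using g le by (intro norm_suminf_le) (auto simp: sums_iff)
    also have "\<dots> = (1/2) ^ Suc k" using g by (simp add: sums_iff)
    also have "\<dots> \<le> 1" by (rule power_le_one) auto
    finally have 1: "cmod (f' z - (\<Sum>j<Suc k. h' j z)) \<le> 1" .
    have "cmod (complex_of_real (a k) * z ^ n k * poly (pderiv (Q k)) z) \<le> 1 * 1 * cmod (poly (pderiv (Q k)) z)"
      using a[of k] z1 unfolding norm_mult
      by (intro mult_mono) (auto simp: norm_power power_le_one)
    moreover have "f' z - main k z = (f' z - (\<Sum>j<Suc k. h' j z)) + poly (pderiv (P k)) z +
        complex_of_real (a k) * z ^ n k * poly (pderiv (Q k)) z"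
      by (simp add: P'_sum h'_def)
    ultimately have "cmod (f' z - main k z) \<le> 1 + cmod (poly (pderiv (P k)) z) + cmod (poly (pderiv (Q k)) z)"
      using 1 by (simp only: mult_1_left) (intro norm_triangle_le add_mono order.refl)
    also have "\<dots> \<le> M k" using M[of z k] z1 by simp
    also have "f' z = deriv f z" using f(3)[OF z1] by (simp add: DERIV_imp_deriv)
    finally show ?thesis .
  qed
  have f_holo: "f holomorphic_on ball 0 1"
    unfolding holomorphic_on_open[OF open_ball] using f(3) mem_ball_0 by metis
  have f_le: "cmod (f z) \<le> B" if "cmod z < 1" for z
  proof (rule LIMSEQ_le_const2)
    show "(\<lambda>k. cmod (poly (P k) z)) \<longlonglongrightarrow> cmod (f z)"
      using f(1)[OF that] unfolding sums_def P_sum by (rule tendsto_norm)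
  qed (use bd(1) that in auto)
  have M_pos: "0 < M k" for k using M1[of k] by simp
  show ?thesis
    by (rule that[where f = f and Q = Q and r = r and M = M and n = n])
      (fact f_holo f_le est[unfolded main_def] lc bd(2) r n(1,4,5) M_pos tail)+
qed

section \<open>Choice of the coefficients and comparison of the two exponents\<close>

theorem theorem4:
  fixes p q :: real
  assumes "0 < q" and "q < min p 2"
  shows "\<exists>f. f \<in> (dirichlet_type p \<inter> Hinf) - (dirichlet_type q \<inter> Hinf)"
proof -
  define a where "a k = real (Suc k) powr (- 1 / q)" for k
  have p: "0 < p" "q < p" and q: "0 < q" "q < 2" using assms by auto
  have a: "0 < a k" "a k \<le> 1" for k
    using q powr_mono[of "- 1 / q" 0 "real (Suc k)"] by (simp_all add: a_def)
  have a_powr: "a k powr s = real (Suc k) powr (- s / q)" for k s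
    by (simp add: a_def powr_powr)
  have a_summable: "summable (\<lambda>k. a k powr s)" if "q < s" for s
  proof -
    have "- s / q < - 1" using that q by (simp add: field_simps)
    then have "summable (\<lambda>k. real k powr (- s / q))"
      by (simp add: summable_real_powr_iff)
    then show ?thesis
      unfolding a_powr by (subst summable_Suc_iff)
  qed
  have a_harmonic: "\<not> summable (\<lambda>k. a k powr q)"
  proof
    assume "summable (\<lambda>k. a k powr q)"
    then have "summable (\<lambda>k. real k powr (- 1))"
      using q unfolding a_powr by (subst (asm) summable_Suc_iff) simp
    then show False using summable_real_powr_iff[of "- 1"] by simp
  qed
  \<comment> \<open>From 1 + x \<le> e^x; the series converges because q < 2. The products are at
    most B, hence at most B^2.\<close>
  define B where "B = exp (\<Sum>k. (a k)\<^sup>2)"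
  have sq: "summable (\<lambda>k. (a k)\<^sup>2)"
    using a_summable[OF q(2)] a by (simp add: less_imp_le)
  have B: "B \<ge> 1"
    unfolding B_def using suminf_nonneg[OF sq] by simp
  have prod: "(\<Prod>j<k. 1 + (a j)\<^sup>2) \<le> B\<^sup>2" for k
  proof -
    have "(\<Prod>j<k. 1 + (a j)\<^sup>2) \<le> (\<Prod>j<k. exp ((a j)\<^sup>2))"
      by (intro prod_mono) (auto simp: exp_ge_add_one_self)
    also have "\<dots> = exp (\<Sum>j<k. (a j)\<^sup>2)" by (simp add: exp_sum)
    also have "\<dots> \<le> B" unfolding B_def using sq by (auto intro: sum_le_suminf)
    also have "\<dots> \<le> B\<^sup>2" using B by (simp add: power2_eq_square)
    finally show ?thesis .
  qed
  obtain f :: "complex \<Rightarrow> complex" and Q :: "nat \<Rightarrow> complex poly"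
    and r M :: "nat \<Rightarrow> real" and n :: "nat \<Rightarrow> nat"
  where f: "f holomorphic_on ball 0 1" "\<And>z. cmod z < 1 \<Longrightarrow> cmod (f z) \<le> B"
    and f': "\<And>k z. r k \<le> cmod z \<Longrightarrow> cmod z < r (Suc k) \<Longrightarrow>
      cmod (deriv f z - complex_of_real (a k) * of_nat (n k) * z ^ (n k - 1) * poly (Q k) z) \<le> M k"
    and lc: "\<And>k. lead_coeff (Q k) = 1"
    and Q: "\<And>k z. cmod z \<le> 1 \<Longrightarrow> cmod (poly (Q k) z) \<le> B"
    and r: "r 0 = 0" "\<And>k. r k < 1" and M: "\<And>k. 0 < M k"
    and rn: "\<And>k. r k \<le> 1 - 2 / n k" "\<And>k. 1 - 1 / n k \<le> r (Suc k)"
    and n: "\<And>k. k + 3 \<le> n k"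
    and pow: "\<And>k. 1 / 2 \<le> (1 - 2 / n k) ^ degree (Q k)" "\<And>k. exp (- 3) \<le> (1 - 2 / n k) ^ n k"
    and tail: "\<And>k s. s \<in> {p, q} \<Longrightarrow>
      ennreal (M k powr s) * (\<integral>\<^sup>+z\<in>ball 0 1 - ball 0 (r k). ennreal ((1 - cmod z) powr (s - 1)) \<partial>lborel)
        \<le> ennreal (disc_kernel_bound s * (1/2) ^ k)"
  proof (rule bounded_function_with_annulus_estimate[of a B "{p, q}"], goal_cases)
    case (7 f r n Q M)
    show ?case by (rule 7(1)) (fact 7)+
  qed (use a B prod p q in auto)
  \<comment> \<open>Extension by zero makes the derivative Borel measurable on the whole
    plane.\<close>
  define g where "g z = indicator (ball 0 1) z *\<^sub>R deriv f z" for z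
  have [measurable]: "g \<in> borel_measurable borel"
    unfolding g_def
    by (intro borel_measurable_continuous_on_indicator holomorphic_on_imp_continuous_on
        holomorphic_deriv f) auto
  define h where "h s z = ennreal ((1 - cmod z) powr (s - 1) * cmod (g z) powr s)" for s z
  have h_meas [measurable]: "h s \<in> borel_measurable borel" for s
    unfolding h_def by measurable
  define I where "I s k = (\<integral>\<^sup>+z\<in>ball 0 (r (Suc k)) - ball 0 (r k). h s z \<partial>lborel)" for s k
  have D_iff: "f \<in> dirichlet_type s \<longleftrightarrow> (\<Sum>k. I s k) < \<infinity>" for s
  proof -
    have "(\<integral>\<^sup>+ z \<in> ball 0 1. ennreal ((1 / pi) * (1 - cmod z) powr (s - 1) * cmod (deriv f z) powr s) \<partial>lborel)
      = (\<integral>\<^sup>+ z. ennreal (1 / pi) * (h s z * indicator (ball 0 1) z) \<partial>lborel)"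
      by (intro nn_integral_cong) (auto simp: h_def g_def mult.assoc ennreal_mult'[symmetric] split: split_indicator)
    also have "\<dots> = ennreal (1 / pi) * (\<integral>\<^sup>+ z \<in> ball 0 1. h s z \<partial>lborel)"
      by (rule nn_integral_cmult) measurable
    also have "(\<integral>\<^sup>+ z \<in> ball 0 1. h s z \<partial>lborel) = (\<Sum>k. I s k)"
      unfolding I_def
    proof (rule suminf_nn_integral_annuli[symmetric])
      have "r k \<le> r (Suc k)" for k
      proof -
        have "1 / real (n k) \<le> 2 / n k" by (simp add: divide_right_mono)
        then show ?thesis using rn[of k] by linarith
      qed
      then show "mono r" by (simp add: mono_iff_le_Suc)
      have "(\<lambda>k. r (Suc k)) \<longlonglongrightarrow> 1"
      proof (rule tendsto_sandwich)
        show "(\<lambda>k. 1 - 1 / real (Suc k)) \<longlonglongrightarrow> 1"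
          using tendsto_diff[OF tendsto_const LIMSEQ_inverse_real_of_nat, of 1]
          by (simp add: inverse_eq_divide)
        \<comment> \<open>From n k \<ge> k + 3, so the radii are squeezed to 1 and the annuli
          exhaust the disc.\<close>
        have "1 - 1 / real (Suc k) \<le> r (Suc k)" for k
        proof -
          have "1 / real (n k) \<le> 1 / real (Suc k)"
            using n[of k] by (intro divide_left_mono) auto
          then show ?thesis using rn(2)[of k] by linarith
        qed
        then show "\<forall>\<^sub>F k in sequentially. 1 - 1 / real (Suc k) \<le> r (Suc k)" by simp
        show "\<forall>\<^sub>F k in sequentially. r (Suc k) \<le> 1" using r(2) by (simp add: less_imp_le)
      qed simp
      then show "r \<longlonglongrightarrow> 1" by (rule LIMSEQ_imp_Suc)
      show "r k \<le> 1" for k using r(2)[of k] by simp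
    qed (use r(1) in simp_all)
    finally show ?thesis
      using f(1) pi_gt_zero
      by (auto simp: dirichlet_type_def ennreal_mult_less_top ennreal_eq_0_iff simp del: pi_gt_zero)
  qed
  have g': "cmod (g z - complex_of_real (a k) * of_nat (n k) * z ^ (n k - 1) * poly (Q k) z) \<le> M k"
    if "r k \<le> cmod z" "cmod z < r (Suc k)" for k z
    using f'[OF that] that r(2)[of "Suc k"] by (simp add: g_def)
  have T: "summable (\<lambda>k. disc_kernel_bound s * (1/2) ^ k)" for s
    by (intro summable_mult summable_geometric) simp
  have "f \<in> dirichlet_type p"
  proof -
    \<comment> \<open>A geometric error plus a multiple of (a k)^p; both are summable, the latter
      because p > q.\<close>
    define u where "u k = 2 powr p * (disc_kernel_bound p * (1/2) ^ k + (a k * B) powr p * disc_kernel_bound p)" for k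
    have "I p k \<le> ennreal (u k)" for k
      unfolding I_def h_def u_def using a(1)[of k] B M[of k] r(2)[of "Suc k"] n[of k] p disc_kernel_bound_pos[of p]
      by (intro annulus_integral_upper[where n = "n k" and Q = "poly (Q k)" and M = "M k"] Q g' tail) auto
    then have "(\<Sum>k. I p k) \<le> (\<Sum>k. ennreal (u k))"
      by (intro suminf_le) auto
    also have "\<dots> < \<infinity>"
    proof -
      have "summable u"
        unfolding u_def using a(1) B a_summable[OF p(2)] T
        by (auto intro!: summable_mult summable_add summable_mult2 simp: powr_mult less_imp_le)
      moreover have "0 \<le> u k" for k
        using disc_kernel_bound_pos[OF p(1)] by (simp add: u_def)
      ultimately have "(\<Sum>k. ennreal (u k)) \<noteq> top"
        by (rule ennreal_suminf_neq_top)
      then show ?thesis by (simp add: less_top)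
    qed
    finally show ?thesis by (simp add: D_iff)
  qed
  moreover have "f \<notin> dirichlet_type q"
  proof
    assume "f \<in> dirichlet_type q"
    then have fin: "(\<Sum>k. I q k) < \<infinity>" by (simp add: D_iff)
    define c where "c = pi / 8 * exp (- 3 * q) * B powr (q - 2)"
    have c: "c > 0" using B by (simp add: c_def)
    \<comment> \<open>The lower bound is available because q < 2. Its left side is c/(k+1), so
      finite annulus contributions would make the harmonic series converge.\<close>
    have "ennreal (c * a k powr q) \<le> ennreal (2 powr q) * (I q k + ennreal (disc_kernel_bound q * (1/2) ^ k))" for k
      unfolding I_def h_def c_def using a(1)[of k] B M[of k] r(2)[of "Suc k"] n[of k] q
      by (intro annulus_integral_lower[where n = "n k" and Q = "Q k" and M = "M k"] lc Q g' tail pow rn) auto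
    then have "(\<Sum>k. ennreal (c * a k powr q)) \<le>
        (\<Sum>k. ennreal (2 powr q) * (I q k + ennreal (disc_kernel_bound q * (1/2) ^ k)))"
      by (intro suminf_le) auto
    also have "\<dots> = ennreal (2 powr q) * ((\<Sum>k. I q k) + (\<Sum>k. ennreal (disc_kernel_bound q * (1/2) ^ k)))"
      by (simp add: ennreal_suminf_cmult suminf_add)
    also have "\<dots> < \<infinity>"
    proof -
      have "(\<Sum>k. ennreal (disc_kernel_bound q * (1/2) ^ k)) \<noteq> top"
        using T disc_kernel_bound_pos[OF q(1)] by (intro ennreal_suminf_neq_top) auto
      then show ?thesis using fin by (simp add: ennreal_mult_less_top less_top)
    qed
    finally have "summable (\<lambda>k. c * a k powr q)"
      using c by (intro summable_suminf_not_top) auto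
    then show False using c a_harmonic by (simp add: summable_cmult_iff)
  qed
  moreover have "f \<in> Hinf"
    unfolding Hinf_def bounded_iff using f by (auto intro!: exI[of _ B])
  ultimately show ?thesis by blast
qed

end
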